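(* Let $q$ be a power of a prime. If a pure $((n,K,R,d))_q$ subsystem code exists, then there exists a pure $((n-1,qK,R,d-1))_q$ subsystem code.
   Context: Let $p$ be the characteristic of the finite field $\mathbf{F}_q$. For $(x|y)\in\mathbf{F}_q^{2n}$ (with $x,y\in\mathbf{F}_q^n$), the symplectic weight $\mathrm{swt}(x|y)$ is the number of indices $i$ with $(x_i,y_i)\ne(0,0)$, and $\mathrm{swt}(S)$ is the minimum of $\mathrm{swt}$ over the nonzero elements of $S\subseteq\mathbf{F}_q^{2n}$. The trace-symplectic product of $(a|b)$ and $(a'|b')$ is $\mathrm{tr}_{q/p}(a'\cdot b-a\cdot b')$, and $C^{\perp_s}$ is the dual of $C\subseteq\mathbf{F}_q^{2n}$ with respect to it. An $((n,K,R,d))_q$ subsystem code is a subspace $Q=A\otimes B$ of $\mathbf{C}^{q^n}$ with $\dim A=K$ and $\dim B=R$ such that all errors of weight less than $d$ can be detected by the subsystem $A$. All subsystem codes are assumed to be Clifford subsystem codes, that is, codes derived from a classical additive code $C\le\mathbf{F}_q^{2n}$ with $C\ne\{0\}$ as follows: with $D=C\cap C^{\perp_s}$ one has $|C|=q^nR/K$, $|D|=q^n/(KR)$, and the minimum distance is $d=\mathrm{swt}(D^{\perp_s}\setminus C)$ if $D^{\perp_s}\ne C$, and $d=\mathrm{swt}(D^{\perp_s})$ if $D^{\perp_s}=C$. The subsystem code derived from $C$ is called pure to $d'$ if $C$ contains no nonzero element of symplectic weight less than $d'$; it is called pure if it is pure to its minimum distance $d$. An $((n,1,R,d))_q$ subsystem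 code is required to be pure.
   Formalization: Assumes d ≥ 2 (for d = 1 the new minimum distance would be 0, which no code has), and lets the new code's classical additive code be {0} when qK = q^(n-1), where the cardinality conditions force it, e.g. ((4,4,1,2))_2 to ((3,8,1,1))_2. *)

theory Defs
  imports
    Complex_Main
    "HOL-Library.Cardinality"
    "HOL-Computational_Algebra.Primes"
    "Jordan_Normal_Form.Matrix"
begin

section \<open>Additive codes over a finite field and the trace-symplectic form\<close>

text \<open>The pair \<open>(x, y)\<close> of vectors of length \<open>n\<close> encodes the element \<open>(x|y)\<close> of
  \<open>F\<^sub>q\<^sup>2\<^sup>n\<close>, where \<open>F\<^sub>q\<close> is a type of class \<^class>\<open>finite_field\<close> with \<open>q\<close> elements.\<close>

type_synonym 'a word = "'a vec \<times> 'a vec"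

definition word_space :: "nat \<Rightarrow> 'a word set" where
  "word_space n = carrier_vec n \<times> carrier_vec n"

definition zero_word :: "nat \<Rightarrow> 'a :: zero word" where
  "zero_word n = (0\<^sub>v n, 0\<^sub>v n)"

definition additive_code :: "nat \<Rightarrow> 'a :: finite_field word set \<Rightarrow> bool" where
  "additive_code n C \<longleftrightarrow>
     C \<subseteq> word_space n \<and> zero_word n \<in> C \<and>
     (\<forall>u\<in>C. \<forall>v\<in>C. (fst u + fst v, snd u + snd v) \<in> C) \<and>
     (\<forall>u\<in>C. (- fst u, - snd u) \<in> C)"

definition swt :: "'a :: zero word \<Rightarrow> nat" where
  "swt u = card {i. i < dim_vec (fst u) \<and> (fst u $ i, snd u $ i) \<noteq> (0, 0)}"

definition swt_set :: "nat \<Rightarrow> 'a :: zero word set \<Rightarrow> nat" where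
  "swt_set n S = Min (swt ` (S - {zero_word n}))"

text \<open>The trace from \<open>F\<^sub>q\<close> to its prime field \<open>F\<^sub>p\<close>; its values are regarded as elements of
  the prime field inside \<open>F\<^sub>q\<close>.\<close>

definition field_trace :: "'a :: finite_field \<Rightarrow> 'a" where
  "field_trace x = (\<Sum>i < (THE m. CARD('a) = CHAR('a) ^ m). x ^ (CHAR('a) ^ i))"

fun trace_symp :: "'a :: finite_field word \<Rightarrow> 'a word \<Rightarrow> 'a" where
  "trace_symp (a, b) (a', b') = field_trace (a' \<bullet> b - a \<bullet> b')"

definition symp_dual :: "nat \<Rightarrow> 'a :: finite_field word set \<Rightarrow> 'a word set" where
  "symp_dual n C = {u \<in> word_space n. \<forall>v\<in>C. trace_symp u v = 0}"

definition code_radical :: "nat \<Rightarrow> 'a :: finite_field word set \<Rightarrow> 'a word set" where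
  "code_radical n C = C \<inter> symp_dual n C"

definition code_min_dist :: "nat \<Rightarrow> 'a :: finite_field word set \<Rightarrow> nat" where
  "code_min_dist n C =
     (let D' = symp_dual n (code_radical n C)
      in if D' \<noteq> C then swt_set n (D' - C) else swt_set n D')"

definition pure_to :: "nat \<Rightarrow> 'a :: finite_field word set \<Rightarrow> nat \<Rightarrow> bool" where
  "pure_to n C d \<longleftrightarrow> \<not> (\<exists>c\<in>C. c \<noteq> zero_word n \<and> swt c < d)"


section \<open>States and errors\<close>

text \<open>The space \<open>\<complex>\<close> to the power \<open>q\<^sup>n\<close>, with orthonormal basis indexed by the vectors of
  length \<open>n\<close>, is the set of complex functions that vanish off \<^term>\<open>carrier_vec n\<close>.\<close>

type_synonym 'a state = "'a vec \<Rightarrow> complex"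

definition state_space :: "nat \<Rightarrow> 'a state set" where
  "state_space n = {\<psi>. \<forall>x. x \<notin> carrier_vec n \<longrightarrow> \<psi> x = 0}"

definition state_inner :: "nat \<Rightarrow> 'a state \<Rightarrow> 'a state \<Rightarrow> complex" where
  "state_inner n \<phi> \<psi> = (\<Sum>x\<in>carrier_vec n. cnj (\<phi> x) * \<psi> x)"

text \<open>The additive character \<open>x \<mapsto> exp (2 \<pi> \<i> tr(x) / p)\<close>; the \<open>LEAST\<close> term is the representative
  of \<open>tr(x)\<close> in \<open>{0, \<dots>, p - 1}\<close>.\<close>

definition add_char :: "'a :: finite_field \<Rightarrow> complex" where
  "add_char x =
     cis (2 * pi * real (LEAST k. of_nat k = field_trace x) / real CHAR('a))"

text \<open>\<open>error_op n (a, b)\<close> is \<open>X(a) Z(b)\<close>, where \<open>X(a)\<close> maps the basis vector of \<open>x\<close> to that of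
  \<open>x + a\<close> and \<open>Z(b)\<close> multiplies the basis vector of \<open>x\<close> by \<open>add_char (b \<bullet> x)\<close>.\<close>

fun error_op :: "nat \<Rightarrow> 'a :: finite_field word \<Rightarrow> 'a state \<Rightarrow> 'a state" where
  "error_op n (a, b) \<psi> =
     (\<lambda>x. if x \<in> carrier_vec n then add_char (b \<bullet> (x - a)) * \<psi> (x - a) else 0)"


section \<open>Subsystem codes\<close>

text \<open>A subspace \<open>Q = A \<otimes> B\<close> with \<open>dim A = K\<close> and \<open>dim B = R\<close> is given by the orthonormal
  basis \<open>e i j\<close> (\<open>i < K\<close>, \<open>j < R\<close>) of \<open>Q\<close> that consists of the products of the vectors of
  orthonormal bases of \<open>A\<close> and \<open>B\<close>.\<close>

definition product_basis :: "nat \<Rightarrow> nat \<Rightarrow> nat \<Rightarrow> (nat \<Rightarrow> nat \<Rightarrow> 'a state) \<Rightarrow> bool" where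
  "product_basis n K R e \<longleftrightarrow>
     (\<forall>i<K. \<forall>j<R. e i j \<in> state_space n) \<and>
     (\<forall>i<K. \<forall>j<R. \<forall>i'<K. \<forall>j'<R.
        state_inner n (e i j) (e i' j') = (if i = i' \<and> j = j' then 1 else 0))"

text \<open>\<open>E\<close> is detectable by the subsystem \<open>A\<close> if \<open>P E P = 1 \<otimes> G\<close> on \<open>Q\<close> for some operator \<open>G\<close> on
  \<open>B\<close>, where \<open>P\<close> is the orthogonal projector onto \<open>Q\<close>.\<close>

definition detectable ::
    "nat \<Rightarrow> nat \<Rightarrow> nat \<Rightarrow> (nat \<Rightarrow> nat \<Rightarrow> 'a state) \<Rightarrow> ('a state \<Rightarrow> 'a state) \<Rightarrow> bool" where
  "detectable n K R e E \<longleftrightarrow>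
     (\<exists>G :: nat \<Rightarrow> nat \<Rightarrow> complex. \<forall>i<K. \<forall>j<R. \<forall>i'<K. \<forall>j'<R.
        state_inner n (e i j) (E (e i' j')) = (if i = i' then G j j' else 0))"

text \<open>\<open>Q = A \<otimes> B\<close> is derived from \<open>C\<close>: the errors in \<open>C\<close> preserve \<open>Q\<close> and act on it as
  \<open>1 \<otimes> M\<close>, and those in the radical \<open>D\<close> of \<open>C\<close> act as scalars. Under the cardinality conditions
  of the next definition, \<open>Q\<close> is then a full joint eigenspace of \<open>D\<close>, and the action of \<open>C\<close> on
  \<open>B\<close> is irreducible.\<close>

definition derived_from ::
    "nat \<Rightarrow> nat \<Rightarrow> nat \<Rightarrow> 'a :: finite_field word set \<Rightarrow> (nat \<Rightarrow> nat \<Rightarrow> 'a state) \<Rightarrow> bool" where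
  "derived_from n K R C e \<longleftrightarrow>
     (\<forall>c\<in>C. \<exists>M :: nat \<Rightarrow> nat \<Rightarrow> complex. \<forall>i<K. \<forall>j<R.
        error_op n c (e i j) = (\<lambda>x. \<Sum>j'<R. M j' j * e i j' x)) \<and>
     (\<forall>c\<in>code_radical n C. \<exists>z :: complex. \<forall>i<K. \<forall>j<R.
        error_op n c (e i j) = (\<lambda>x. z * e i j x))"

text \<open>A Clifford \<open>((n, K, R, d))\<^sub>q\<close> subsystem code \<open>A \<otimes> B\<close> (with product basis \<open>e\<close>) derived from
  the additive code \<open>C\<close>. The cardinality conditions are \<open>|C| = q\<^sup>n R / K\<close> and
  \<open>|D| = q\<^sup>n / (K R)\<close> with denominators cleared. Every error of weight less than \<open>d\<close> is a
  linear combination of errors \<open>error_op n u\<close> with \<open>swt u < d\<close>, and detectable errors form a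
  linear space. The convention that \<open>C\<close> be nonzero is not built in.\<close>

definition clifford_subsystem_code ::
    "nat \<Rightarrow> nat \<Rightarrow> nat \<Rightarrow> nat \<Rightarrow> 'a :: finite_field word set \<Rightarrow>
     (nat \<Rightarrow> nat \<Rightarrow> 'a state) \<Rightarrow> bool" where
  "clifford_subsystem_code n K R d C e \<longleftrightarrow>
     additive_code n C \<and>
     card C * K = CARD('a) ^ n * R \<and>
     card (code_radical n C) * (K * R) = CARD('a) ^ n \<and>
     d = code_min_dist n C \<and>
     product_basis n K R e \<and>
     derived_from n K R C e \<and>
     (\<forall>u\<in>word_space n. swt u < d \<longrightarrow> detectable n K R e (error_op n u)) \<and>
     (K = 1 \<longrightarrow> pure_to n C d)"

definition pure_subsystem_code ::
    "nat \<Rightarrow> nat \<Rightarrow> nat \<Rightarrow> nat \<Rightarrow> 'a :: finite_field word set \<Rightarrow>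
     (nat \<Rightarrow> nat \<Rightarrow> 'a state) \<Rightarrow> bool" where
  "pure_subsystem_code n K R d C e \<longleftrightarrow>
     clifford_subsystem_code n K R d C e \<and> pure_to n C d"

end

theory Submission
  imports Defs
    "HOL-Algebra.Multiplicative_Group"
    "HOL-Algebra.Sylow"
    "HOL-Computational_Algebra.Polynomial"
    "HOL-Library.Product_Plus"
    "HOL-Number_Theory.Cong"
    "Jordan_Normal_Form.Determinant"
begin

text \<open>Puncture at a coordinate \<open>i\<close> in the support of a word of minimum weight \<open>d\<close> of \<open>D\<^sup>\<bottom>\<close>:
  the new code \<open>C'\<close> is \<open>C\<close> shortened at \<open>i\<close>. As \<open>C\<close> is pure and \<open>d \<ge> 2\<close>, no nonzero word of
  \<open>D\<^sup>\<bottom>\<close> has weight below 2, and counting with \<open>|C| |C\<^sup>\<bottom>| = q\<^sup>2\<^sup>n\<close> shows that the dual of a shortened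
  code is the punctured dual; this yields the radical, the cardinalities and the distance of \<open>C'\<close>.
  The state space needs no representation theory: contracting the basis of \<open>A \<otimes> B\<close> with the \<open>q\<close>
  basis vectors at coordinate \<open>i\<close> and rescaling by \<open>\<surd>q\<close> gives \<open>q K R\<close> vectors. Their inner products
  are combinations of matrix entries of errors of weight at most 1, and by purity nonzero errors
  of weight less than \<open>d\<close> have vanishing entries on \<open>A \<otimes> B\<close>; so these vectors are orthonormal.\<close>

section \<open>The trace and the additive character\<close>

text \<open>Cauchy's theorem for the additive group, by way of Sylow: a nonzero \<open>x\<close> in
  a subgroup of order \<open>r\<close> satisfies \<open>of_nat r * x = 0\<close>, so the
  characteristic divides \<open>r\<close>.\<close>

lemma prime_dvd_CARD_imp_eq_CHAR:
  assumes r: "prime r" and dvd: "r dvd CARD('a :: finite_field)"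
  shows "r = CHAR('a)"
proof (rule ccontr)
  assume ne: "r \<noteq> CHAR('a)"
  define G where "G = \<lparr>carrier = (UNIV :: 'a set), monoid.mult = (+), one = (0 :: 'a)\<rparr>"
  interpret G: group G
  proof (rule groupI)
    fix x assume "x \<in> carrier G"
    show "\<exists>y\<in>carrier G. y \<otimes>\<^bsub>G\<^esub> x = \<one>\<^bsub>G\<^esub>"
      by (intro bexI[of _ "- x"]) (auto simp: G_def)
  qed (auto simp: G_def add_ac)
  have pow: "x [^]\<^bsub>G\<^esub> k = of_nat k * x" for x :: 'a and k :: nat
    by (induction k) (auto simp: G_def nat_pow_def algebra_simps)
  obtain m where m: "CARD('a) = r ^ 1 * m" using dvd by auto
  have "Coset.order G = r ^ 1 * m"
    using m by (simp add: Coset.order_def G_def)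
  moreover have "finite (carrier G)" by (simp add: G_def)
  ultimately obtain H where H: "subgroup H G" "card H = r"
    using sylow_thm[OF r G.group_axioms, of 1 m] by auto
  have "card H > 1" using H(2) r prime_gt_1_nat by simp
  hence "\<not> H \<subseteq> {0}" using card_mono[of "{0}" H] by auto
  then obtain x where x: "x \<in> H" "x \<noteq> 0" by auto
  interpret H: group "G\<lparr>carrier := H\<rparr>"
    using H(1) by (rule G.subgroup_imp_group)
  have "x [^]\<^bsub>G\<lparr>carrier := H\<rparr>\<^esub> r = \<one>\<^bsub>G\<lparr>carrier := H\<rparr>\<^esub>"
    using H.pow_order_eq_1[of x] x(1) H(2) by (simp add: Coset.order_def)
  hence "of_nat r * x = 0"
    using pow[of x r] by (simp add: G_def nat_pow_def)
  hence "CHAR('a) dvd r" using x(2) by (simp add: of_nat_eq_0_iff_char_dvd)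
  thus False using ne r primes_dvd_imp_eq[of "CHAR('a)" r] by simp
qed

text \<open>The definite description in \<open>field_trace\<close> denotes an exponent only once one
  is known to exist. Every prime divisor of the cardinality is the characteristic, so the cofactor
  of its largest power is 1.\<close>

lemma CARD_eq_CHAR_power: "\<exists>m>0. CARD('a :: finite_field) = CHAR('a) ^ m"
proof -
  let ?p = "CHAR('a)"
  have p: "prime ?p" by simp
  have "CARD('a) \<noteq> 0" by simp
  then obtain m where m: "CARD('a) = ?p ^ multiplicity ?p CARD('a) * m" "\<not> ?p dvd m"
    using multiplicity_decompose'[of "CARD('a)" ?p] p not_prime_unit by metis
  have "m = 1"
  proof (rule ccontr)
    assume "m \<noteq> 1"
    then obtain r where r: "prime r" "r dvd m" using prime_factor_nat by blast
    have "r dvd CARD('a)" using r(2) m(1) by (metis dvd_mult)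
    with prime_dvd_CARD_imp_eq_CHAR[OF r(1), where 'a = 'a] r(2) m(2) show False by simp
  qed
  hence eq: "CARD('a) = ?p ^ multiplicity ?p CARD('a)" using m(1) by simp
  moreover have "CARD('a) \<noteq> 1"
    by (metis UNIV_I card_1_singletonE singletonD zero_neq_one)
  ultimately show ?thesis by (metis gr0I power_0)
qed

lemma CHAR_gt_1: "CHAR('a :: finite_field) > 1"
  using prime_gt_1_nat[of "CHAR('a)"] by simp

lemma CARD_finite_field_gt_1: "CARD('a :: finite_field) > 1"
  using CARD_eq_CHAR_power[where 'a = 'a] CHAR_gt_1[where 'a = 'a] by (metis one_less_power)

section \<open>The trace: additivity, values in the prime field, nonvanishing\<close>

lemma field_trace_eq:
  assumes "CARD('a :: finite_field) = CHAR('a) ^ m"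
  shows "field_trace (x :: 'a) = (\<Sum>i<m. x ^ (CHAR('a) ^ i))"
proof -
  have "(THE m. CARD('a) = CHAR('a) ^ m) = m"
    using assms CHAR_gt_1[where 'a = 'a] by (intro the_equality) auto
  thus ?thesis by (simp add: field_trace_def)
qed

lemma field_trace_add: "field_trace (x + y) = field_trace x + field_trace (y :: 'a :: finite_field)"
  by (simp add: field_trace_def freshmans_dream'[OF _ refl] sum.distrib)

lemma field_trace_0 [simp]: "field_trace (0 :: 'a :: finite_field) = 0"
  by (simp add: field_trace_def power_0_left)

lemma field_trace_uminus: "field_trace (- x) = - field_trace (x :: 'a :: finite_field)"
  using field_trace_add[of x "- x"] by (simp add: minus_unique)

text \<open>Frobenius permutes the summands of the trace cyclically, because
  \<open>x ^ CARD('a) = x\<close> turns the image of the last one into the first.\<close>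

lemma field_trace_power_CHAR:
  "field_trace x ^ CHAR('a) = field_trace (x :: 'a :: finite_field)"
proof -
  obtain m where m: "m > 0" "CARD('a) = CHAR('a) ^ m"
    using CARD_eq_CHAR_power by blast
  then obtain k where k: "m = Suc k" using gr0_implies_Suc by blast
  have last: "x ^ (CHAR('a) ^ m) = x"
    using finite_field_power_card_eq_same[of x] m by simp
  have "field_trace x ^ CHAR('a) = (\<Sum>i<m. (x ^ (CHAR('a) ^ i)) ^ CHAR('a))"
    by (simp add: field_trace_eq[OF m(2)] freshmans_dream_sum[OF _ refl])
  also have "\<dots> = (\<Sum>i<m. x ^ (CHAR('a) ^ Suc i))"
    by (simp add: power_mult [symmetric] mult.commute)
  also have "\<dots> = (\<Sum>i<k. x ^ (CHAR('a) ^ Suc i)) + x"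
    unfolding k sum.lessThan_Suc using last unfolding k by (rule arg_cong)
  also have "\<dots> = field_trace x"
    unfolding field_trace_eq[OF m(2)] k sum.lessThan_Suc_shift power_0 power_one_right
    by (rule add.commute)
  finally show ?thesis .
qed

text \<open>The prime field is the root set of \<open>X\<^sup>p - X\<close>, which has at most \<open>p\<close> elements.\<close>

lemma power_CHAR_eq_imp_of_nat:
  assumes "(y :: 'a :: finite_field) ^ CHAR('a) = y"
  shows "\<exists>k<CHAR('a). y = of_nat k"
proof -
  let ?p = "CHAR('a)"
  define P :: "'a poly" where "P = monom 1 ?p - [:0, 1:]"
  have deg: "degree P = ?p"
    unfolding P_def using CHAR_gt_1[where 'a = 'a]
    by (subst diff_conv_add_uminus, subst degree_add_eq_left) (auto simp: degree_monom_eq)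
  have P0: "P \<noteq> 0" using deg CHAR_gt_1[where 'a = 'a] by auto
  have roots: "poly P x = 0 \<longleftrightarrow> x ^ ?p = x" for x
    by (simp add: P_def poly_monom)
  have inj: "inj_on (of_nat :: nat \<Rightarrow> 'a) {..<?p}"
    by (intro inj_onI) (auto simp: of_nat_eq_iff_cong_CHAR cong_def)
  have of_nat_pow: "(of_nat k :: 'a) ^ ?p = of_nat k" for k
  proof (induction k)
    case (Suc k)
    thus ?case
      using freshmans_dream[where 'a = 'a, of ?p 1 "of_nat k"] by simp
  qed (use CHAR_gt_1[where 'a = 'a] in simp)
  have "of_nat ` {..<?p} = {x. poly P x = 0}"
  proof (rule card_seteq)
    show "finite {x. poly P x = 0}" by simp
    show "of_nat ` {..<?p} \<subseteq> {x. poly P x = 0}" by (auto simp: roots of_nat_pow)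
    show "card {x. poly P x = 0} \<le> card ((of_nat :: nat \<Rightarrow> 'a) ` {..<?p})"
      using card_poly_roots_bound[OF P0] by (simp add: deg card_image[OF inj])
  qed
  moreover have "y \<in> {x. poly P x = 0}" using assms by (simp add: roots)
  ultimately show ?thesis by (metis imageE lessThan_iff)
qed

text \<open>Makes the set under \<open>LEAST\<close> in \<open>add_char\<close> nonempty and
  supplies representatives for computing with the character.\<close>

lemma field_trace_of_nat: "\<exists>k<CHAR('a). of_nat k = field_trace (x :: 'a :: finite_field)"
  using power_CHAR_eq_imp_of_nat[OF field_trace_power_CHAR[of x]] by metis

text \<open>Otherwise the trace polynomial, which is nonzero of degree at most \<open>q/p\<close>,
  would have all \<open>q\<close> field elements as roots.\<close>

lemma field_trace_nonzero: "\<exists>x :: 'a :: finite_field. field_trace x \<noteq> 0"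
proof (rule ccontr)
  assume "\<not> ?thesis"
  hence zero: "field_trace x = 0" for x :: 'a by simp
  obtain m where m: "m > 0" "CARD('a) = CHAR('a) ^ m"
    using CARD_eq_CHAR_power by blast
  then obtain k where k: "m = Suc k" using gr0_implies_Suc by blast
  define P :: "'a poly" where "P = (\<Sum>i<m. monom 1 (CHAR('a) ^ i))"
  have "coeff P (CHAR('a) ^ k) = (\<Sum>i<m. if i = k then 1 else 0)"
    unfolding P_def using CHAR_gt_1[where 'a = 'a] by (auto simp: coeff_sum intro!: sum.cong)
  hence P0: "P \<noteq> 0" using k by auto
  have "degree P \<le> CHAR('a) ^ k"
    unfolding P_def using CHAR_gt_1[where 'a = 'a] k
    by (intro degree_sum_le) (auto intro!: order.trans[OF degree_monom_le] power_increasing)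
  moreover have "CHAR('a) ^ k < CARD('a)"
    using CHAR_gt_1[where 'a = 'a] m k by simp
  moreover have "poly P x = 0" for x
    using zero[of x] by (simp add: P_def poly_sum poly_monom field_trace_eq[OF m(2)])
  hence "card {x. poly P x = 0} = CARD('a)" by simp
  ultimately show False using card_poly_roots_bound[OF P0] by simp
qed

text \<open>Two representatives differ by a multiple of the characteristic, which changes the angle
  by a multiple of \<open>2 * pi\<close>. Later computations may thus use any representative instead
  of the least one.\<close>

lemma add_char_eq_cis:
  assumes "of_nat k = field_trace (x :: 'a :: finite_field)"
  shows "add_char x = cis (2 * pi * real k / real CHAR('a))"
proof -
  define l where "l = (LEAST k. of_nat k = field_trace x)"
  have "of_nat l = field_trace x" unfolding l_def using assms by (rule LeastI)
  hence "of_nat l = (of_nat k :: 'a)" using assms by simp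
  hence cong: "[l = k] (mod CHAR('a))" by (simp add: of_nat_eq_iff_cong_CHAR)
  have le: "l \<le> k" unfolding l_def using assms by (rule Least_le)
  then obtain t where t: "k = l + t * CHAR('a)"
    using cong by (metis cong_le_nat cong_sym add.commute)
  have "2 * pi * real k / real CHAR('a) = 2 * pi * real l / real CHAR('a) + 2 * pi * real t"
    using CHAR_gt_1[where 'a = 'a] by (simp add: t add_divide_distrib ring_distribs)
  hence "cis (2 * pi * real k / real CHAR('a)) =
    cis (2 * pi * real l / real CHAR('a)) * cis (2 * pi * real t)"
    by (simp only: cis_mult)
  moreover have "cis (2 * pi * real t) = 1"
    using cis_multiple_2pi[of "real t"] by simp
  ultimately show ?thesis by (simp add: add_char_def l_def)
qed

lemma add_char_add: "add_char (x + y) = add_char x * add_char (y :: 'a :: finite_field)"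
proof -
  obtain k l where kl: "of_nat k = field_trace x" "of_nat l = field_trace y"
    using field_trace_of_nat by metis
  hence "of_nat (k + l) = field_trace (x + y)" by (simp add: field_trace_add)
  from add_char_eq_cis[OF this] add_char_eq_cis[OF kl(1)] add_char_eq_cis[OF kl(2)]
  show ?thesis by (simp add: cis_mult ring_distribs add_divide_distrib)
qed

lemma add_char_0 [simp]: "add_char (0 :: 'a :: finite_field) = 1"
  using add_char_eq_cis[of 0 "0 :: 'a"] by simp

lemma norm_add_char [simp]: "norm (add_char x) = 1"
  by (simp add: add_char_def)

lemma add_char_nonzero [simp]: "add_char x \<noteq> 0"
  by (simp add: add_char_def)

lemma add_char_uminus: "add_char (- x) = cnj (add_char (x :: 'a :: finite_field))"
proof -
  have "add_char x * add_char (- x) = 1" by (simp flip: add_char_add)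
  moreover have "add_char x * cnj (add_char x) = 1"
    by (simp add: complex_norm_square [symmetric])
  ultimately show ?thesis by (metis add_char_nonzero mult_left_cancel)
qed

text \<open>Links the algebraic and the analytic side: trace-orthogonality of words becomes
  triviality of a phase.\<close>

lemma add_char_eq_1_iff: "add_char x = 1 \<longleftrightarrow> field_trace (x :: 'a :: finite_field) = 0"
proof
  assume *: "add_char x = 1"
  obtain k where k: "k < CHAR('a)" "of_nat k = field_trace x"
    using field_trace_of_nat by metis
  have "cos (2 * pi * real k / real CHAR('a)) = 1"
    using * add_char_eq_cis[OF k(2)] by (simp add: complex_eq_iff)
  then obtain n :: int where n: "2 * pi * real k / real CHAR('a) = of_int n * 2 * pi"
    using cos_one_2pi_int by auto
  hence "real k = of_int n * real CHAR('a)"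
    using CHAR_gt_1[where 'a = 'a] by (simp add: field_simps)
  hence "int k = n * int CHAR('a)"
    by (metis of_int_eq_iff of_int_mult of_int_of_nat_eq)
  hence "int CHAR('a) dvd int k" by simp
  hence "CHAR('a) dvd k" by presburger
  thus "field_trace x = 0" using k(2) by (metis of_nat_eq_0_iff_char_dvd)
next
  assume "field_trace x = 0"
  thus "add_char x = 1" using add_char_eq_cis[of 0 x] by simp
qed

text \<open>All orthogonality relations below come from translating the index of summation by an
  element on which the character is not 1.\<close>

lemma sum_eq_0_of_scaled:
  fixes f :: "'b \<Rightarrow> complex"
  assumes "bij_betw t S S" "\<And>x. x \<in> S \<Longrightarrow> f (t x) = z * f x" "z \<noteq> 1"
  shows "sum f S = 0"
proof -
  have "sum f S = (\<Sum>x\<in>S. f (t x))" by (rule sum.reindex_bij_betw [OF assms(1), symmetric])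
  also have "\<dots> = z * sum f S" by (simp add: assms(2) sum_distrib_left)
  finally show ?thesis using assms(3) by (simp add: algebra_simps)
qed

lemma sum_add_char:
  "(\<Sum>b\<in>UNIV. add_char (b * c)) = (if c = 0 then of_nat CARD('a) else (0 :: complex))"
  for c :: "'a :: finite_field"
proof (cases "c = 0")
  case False
  obtain y :: 'a where y: "field_trace y \<noteq> 0" using field_trace_nonzero by blast
  have "(\<Sum>b\<in>UNIV. add_char (b * c)) = (0 :: complex)"
  proof (rule sum_eq_0_of_scaled)
    \<comment> \<open>Translation of \<open>b\<close> by \<open>y / c\<close> moves the argument
      \<open>b * c\<close> by exactly \<open>y\<close>, so every term picks up the same factor
      \<open>add_char y\<close>.\<close>
    show "bij_betw (\<lambda>b. b + y / c) UNIV UNIV" by (simp add: bij_plus_right)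
    show "add_char ((b + y / c) * c) = add_char y * add_char (b * c)" for b
      using False by (simp add: ring_distribs add_char_add)
    show "add_char y \<noteq> 1" using y by (simp add: add_char_eq_1_iff)
  qed
  with False show ?thesis by simp
qed simp


section \<open>Inserting a coordinate\<close>

definition vec_insert :: "nat \<Rightarrow> 'a \<Rightarrow> 'a vec \<Rightarrow> 'a vec" where
  "vec_insert i k x = vec (Suc (dim_vec x)) (\<lambda>j. if j = i then k else x $ delete_index i j)"

lemma dim_vec_insert [simp]: "dim_vec (vec_insert i k x) = Suc (dim_vec x)"
  by (simp add: vec_insert_def)

lemma vec_insert_carrier [simp]: "vec_insert i k x \<in> carrier_vec (Suc n) \<longleftrightarrow> x \<in> carrier_vec n"
  by (metis carrier_vecD carrier_vecI dim_vec_insert nat.inject)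

lemma vec_insert_same: "i \<le> dim_vec x \<Longrightarrow> vec_insert i k x $ i = k"
  by (simp add: vec_insert_def)

lemma vec_insert_insert_index: "j < dim_vec x \<Longrightarrow> vec_insert i k x $ insert_index i j = x $ j"
  by (simp add: vec_insert_def insert_index_def delete_index_def)

lemma insert_index_image': "i \<le> n \<Longrightarrow> {0..<Suc n} = insert i (insert_index i ` {0..<n})"
  using insert_index_image[of i n] by auto

lemma insert_index_neq: "insert_index i j \<noteq> i"
  by (simp add: insert_index_def)

lemma delete_index_less: "i \<le> n \<Longrightarrow> j < Suc n \<Longrightarrow> j \<noteq> i \<Longrightarrow> delete_index i j < n"
  by (auto simp: delete_index_def)

lemma sum_lessThan_Suc_insert_index:
  fixes f :: "nat \<Rightarrow> 'b :: comm_monoid_add"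
  assumes "i \<le> n"
  shows "(\<Sum>j\<in>{0..<Suc n}. f j) = f i + (\<Sum>j\<in>{0..<n}. f (insert_index i j))"
  unfolding insert_index_image'[OF assms]
  by (subst sum.insert) (auto simp: insert_index_neq[symmetric] sum.reindex[OF insert_index_inj_on])

lemma vec_insert_add:
  fixes x y :: "'a :: plus vec"
  assumes "i \<le> n" "x \<in> carrier_vec n" "y \<in> carrier_vec n"
  shows "vec_insert i k x + vec_insert i l y = vec_insert i (k + l) (x + y)"
  using assms by (intro eq_vecI) (auto simp: vec_insert_def delete_index_less)

lemma vec_insert_minus:
  fixes x y :: "'a :: minus vec"
  assumes "i \<le> n" "x \<in> carrier_vec n" "y \<in> carrier_vec n"
  shows "vec_insert i k x - vec_insert i l y = vec_insert i (k - l) (x - y)"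
  using assms by (intro eq_vecI) (auto simp: vec_insert_def delete_index_less)

lemma vec_insert_uminus:
  fixes x :: "'a :: uminus vec"
  assumes "i \<le> n" "x \<in> carrier_vec n"
  shows "- vec_insert i k x = vec_insert i (- k) (- x)"
  using assms by (intro eq_vecI) (auto simp: vec_insert_def delete_index_less)

lemma vec_insert_zero: "i \<le> n \<Longrightarrow> vec_insert i 0 (0\<^sub>v n) = 0\<^sub>v (Suc n)"
  by (intro eq_vecI) (auto simp: vec_insert_def delete_index_less)

lemma vec_insert_scalar_prod:
  fixes x y :: "'a :: comm_semiring_0 vec"
  assumes "i \<le> n" "x \<in> carrier_vec n" "y \<in> carrier_vec n"
  shows "vec_insert i k x \<bullet> vec_insert i l y = k * l + x \<bullet> y"
  using assms
  by (simp add: scalar_prod_def sum_lessThan_Suc_insert_index[OF assms(1)] vec_insert_same vec_insert_insert_index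
    del: sum.op_ivl_Suc)

text \<open>The inverse reads off coordinate \<open>i\<close> and deletes it. Injectivity, case
  analysis, splitting of sums and counting all come from this bijection.\<close>

lemma bij_betw_vec_insert:
  assumes "i \<le> n"
  shows "bij_betw (\<lambda>(k, x). vec_insert i k x) (UNIV \<times> carrier_vec n) (carrier_vec (Suc n))"
proof (rule bij_betw_byWitness)
  let ?del = "\<lambda>y. (y $ i, vec n (\<lambda>j. y $ insert_index i j))"
  show "\<forall>a\<in>UNIV \<times> carrier_vec n. ?del (case a of (k, x) \<Rightarrow> vec_insert i k x) = a"
    using assms by (auto simp: vec_insert_same vec_insert_insert_index intro!: eq_vecI)
  show "\<forall>a\<in>carrier_vec (Suc n). (case ?del a of (k, x) \<Rightarrow> vec_insert i k x) = a"
    using assms by (auto simp: vec_insert_def insert_delete_index delete_index_less intro!: eq_vecI)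
qed auto

lemma vec_insert_inject:
  assumes "i \<le> n" "x \<in> carrier_vec n" "y \<in> carrier_vec n"
  shows "vec_insert i k x = vec_insert i l y \<longleftrightarrow> k = l \<and> x = y"
  using bij_betw_imp_inj_on[OF bij_betw_vec_insert[OF assms(1)]] assms(2,3)
  by (fastforce simp: inj_on_def)

lemma vec_insert_cases:
  assumes "i \<le> n" "y \<in> carrier_vec (Suc n)"
  obtains k x where "x \<in> carrier_vec n" "y = vec_insert i k x"
  using bij_betw_imp_surj_on[OF bij_betw_vec_insert[OF assms(1)]] assms(2) by fastforce

lemma sum_carrier_vec_Suc:
  assumes "i \<le> n"
  shows "(\<Sum>y\<in>carrier_vec (Suc n). f y) = (\<Sum>k\<in>UNIV. \<Sum>x\<in>carrier_vec n. f (vec_insert i k x))"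
  using sum.reindex_bij_betw[OF bij_betw_vec_insert[OF assms], of f]
  by (simp add: sum.cartesian_product case_prod_unfold)

lemma finite_card_carrier_vec:
  "finite (carrier_vec n :: 'a :: finite vec set) \<and> card (carrier_vec n :: 'a vec set) = CARD('a) ^ n"
proof (induction n)
  case 0
  have "carrier_vec 0 = {vNil :: 'a vec}" by auto
  thus ?case by simp
next
  case (Suc n)
  show ?case
    using bij_betw_same_card[OF bij_betw_vec_insert[of n n, where 'a = 'a]]
      bij_betw_finite[OF bij_betw_vec_insert[of n n, where 'a = 'a]] Suc
    by (simp add: card_cartesian_product)
qed

lemma finite_carrier_vec [simp]: "finite (carrier_vec n :: 'a :: finite vec set)"
  by (simp add: finite_card_carrier_vec)


section \<open>Words and the symplectic form\<close>

lemma finite_word_space [simp]: "finite (word_space n :: 'a :: finite word set)"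
  by (simp add: word_space_def)

lemma card_word_space: "card (word_space n :: 'a :: finite word set) = CARD('a) ^ (2 * n)"
  by (simp add: word_space_def card_cartesian_product finite_card_carrier_vec mult_2 power_add)

lemma zero_word_in [simp]: "zero_word n \<in> word_space n"
  by (simp add: zero_word_def word_space_def)

lemma word_space_add:
  "u \<in> word_space n \<Longrightarrow> v \<in> word_space n \<Longrightarrow> u + v \<in> word_space n"
  by (auto simp: word_space_def)

lemma word_space_uminus: "u \<in> word_space n \<Longrightarrow> - u \<in> word_space n"
  for u :: "'a :: group_add word"
  by (auto simp: word_space_def)

lemma word_add_uminus_cancel:
  fixes u v :: "'a :: ab_group_add word"
  assumes "u \<in> word_space n" "v \<in> word_space n"
  shows "u + v + - v = u" "u + - v + v = u"
  using assms by (auto simp: word_space_def prod_eq_iff intro!: eq_vecI)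

lemma word_add_uminus_self:
  fixes u :: "'a :: ab_group_add word"
  assumes "u \<in> word_space n"
  shows "u + - u = zero_word n"
  using assms by (auto simp: word_space_def zero_word_def prod_eq_iff)

lemma additive_code_iff:
  "additive_code n C \<longleftrightarrow> C \<subseteq> word_space n \<and> zero_word n \<in> C \<and>
     (\<forall>u\<in>C. \<forall>v\<in>C. u + v \<in> C) \<and> (\<forall>u\<in>C. - u \<in> C)"
  by (simp add: additive_code_def plus_prod_def uminus_prod_def)

lemma additive_code_word_space: "additive_code n (word_space n)"
  by (simp add: additive_code_iff word_space_add word_space_uminus)

lemma additive_code_finite: "additive_code n C \<Longrightarrow> finite C"
  by (rule finite_subset[OF _ finite_word_space[of n]]) (simp add: additive_code_iff)

lemma additive_code_bij_add:
  assumes C: "additive_code n C" and c: "c \<in> C"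
  shows "bij_betw (\<lambda>u. u + c) C C"
proof (rule bij_betw_byWitness[where f' = "\<lambda>u. u + - c"])
  have W: "C \<subseteq> word_space n" using C by (simp add: additive_code_iff)
  show "\<forall>u\<in>C. u + c + - c = u" "\<forall>u\<in>C. u + - c + c = u"
    using subsetD[OF W] c by (simp_all add: word_add_uminus_cancel[where n = n])
  show "(\<lambda>u. u + c) ` C \<subseteq> C" "(\<lambda>u. u + - c) ` C \<subseteq> C"
    using C c by (auto simp: additive_code_iff)
qed

text \<open>The trace is left out because \<open>add_char\<close> applies it itself:
  \<open>add_char (symp u v)\<close> is the phase that arises when the errors \<open>u\<close> and
  \<open>v\<close> are interchanged.\<close>

definition symp :: "'a :: comm_ring word \<Rightarrow> 'a word \<Rightarrow> 'a" where
  "symp u v = fst v \<bullet> snd u - fst u \<bullet> snd v"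

lemma trace_symp_eq: "trace_symp u v = field_trace (symp u v)"
  by (cases u, cases v) (simp add: symp_def)

lemma symp_add_left:
  assumes "u \<in> word_space n" "u' \<in> word_space n" "v \<in> word_space n"
  shows "symp (u + u') v = symp u v + symp u' v"
  using assms
  by (simp add: word_space_def mem_Times_iff symp_def scalar_prod_add_distrib[where n = n]
      add_scalar_prod_distrib[where n = n] algebra_simps)

lemma symp_swap:
  assumes "u \<in> word_space n" "v \<in> word_space n"
  shows "symp v u = - symp u v"
  using assms by (simp add: symp_def)

lemma symp_uminus_left:
  assumes "u \<in> word_space n" "v \<in> word_space n"
  shows "symp (- u) v = - symp u v"
proof -
  have "dim_vec (fst u) = n" "dim_vec (snd u) = n" "dim_vec (fst v) = n" "dim_vec (snd v) = n"
    using assms by (auto simp: word_space_def)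
  thus ?thesis by (simp add: symp_def)
qed

lemma symp_zero_left: "v \<in> word_space n \<Longrightarrow> symp (zero_word n) v = 0"
  by (auto simp: word_space_def symp_def zero_word_def)

lemma trace_symp_swap_eq_0_iff:
  assumes "u \<in> word_space n" "v \<in> word_space n"
  shows "trace_symp v u = 0 \<longleftrightarrow> trace_symp u v = 0"
  using symp_swap[OF assms] by (simp add: trace_symp_eq field_trace_uminus)

lemma trace_symp_nondegenerate:
  fixes c :: "'a :: finite_field word"
  assumes c: "c \<in> word_space n" "c \<noteq> zero_word n"
  shows "\<exists>u\<in>word_space n. trace_symp u c \<noteq> 0"
proof -
  obtain a b where ab: "c = (a, b)" "a \<in> carrier_vec n" "b \<in> carrier_vec n"
    using c(1) by (auto simp: word_space_def)
  obtain y :: 'a where y: "field_trace y \<noteq> 0" using field_trace_nonzero by blast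
  consider "a \<noteq> 0\<^sub>v n" | "b \<noteq> 0\<^sub>v n" using c(2) ab by (auto simp: zero_word_def)
  thus ?thesis
  proof cases
    case 1
    then obtain j where j: "j < n" "a $ j \<noteq> 0" using ab(2) by (auto simp: vec_eq_iff)
    \<comment> \<open>The scaled unit vector isolates the nonzero entry of \<open>a\<close> and
      rescales it to \<open>y\<close>, whose trace is nonzero.\<close>
    have "symp (0\<^sub>v n, (y / a $ j) \<cdot>\<^sub>v unit_vec n j) c = y"
      using ab j by (simp add: symp_def)
    thus ?thesis using y
      by (intro bexI[of _ "(0\<^sub>v n, (y / a $ j) \<cdot>\<^sub>v unit_vec n j)"])
        (simp_all add: trace_symp_eq word_space_def)
  next
    case 2
    then obtain j where j: "j < n" "b $ j \<noteq> 0" using ab(3) by (auto simp: vec_eq_iff)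
    have "symp ((y / b $ j) \<cdot>\<^sub>v unit_vec n j, 0\<^sub>v n) c = - y"
      using ab j by (simp add: symp_def)
    thus ?thesis using y
      by (intro bexI[of _ "((y / b $ j) \<cdot>\<^sub>v unit_vec n j, 0\<^sub>v n)"])
        (simp_all add: trace_symp_eq word_space_def field_trace_uminus)
  qed
qed

lemma additive_code_symp_dual:
  assumes "C \<subseteq> word_space n"
  shows "additive_code n (symp_dual n C)"
proof -
  have "field_trace (symp (u + u') v) = 0"
    if "u \<in> word_space n" "u' \<in> word_space n" "v \<in> C"
      "field_trace (symp u v) = 0" "field_trace (symp u' v) = 0" for u u' v
    using that subsetD[OF assms] by (simp add: symp_add_left[of _ n] field_trace_add)
  moreover have "field_trace (symp (- u) v) = 0"
    if "u \<in> word_space n" "v \<in> C" "field_trace (symp u v) = 0" for u v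
    using that subsetD[OF assms] by (simp add: symp_uminus_left[of _ n] field_trace_uminus)
  moreover have "field_trace (symp (zero_word n) v) = 0" if "v \<in> C" for v
    using that subsetD[OF assms] by (simp add: symp_zero_left)
  ultimately show ?thesis
    unfolding additive_code_iff symp_dual_def trace_symp_eq
    using word_space_add word_space_uminus by auto
qed

lemma sum_add_char_symp:
  assumes S: "additive_code n S" and c: "c \<in> word_space n"
  shows "(\<Sum>u\<in>S. add_char (symp u c)) =
    (if \<forall>u\<in>S. trace_symp u c = 0 then of_nat (card S) else (0 :: complex))"
proof (cases "\<forall>u\<in>S. trace_symp u c = 0")
  case True
  hence "add_char (symp u c) = 1" if "u \<in> S" for u
    using that by (simp add: add_char_eq_1_iff trace_symp_eq)
  with True show ?thesis by simp
next
  case False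
  then obtain v where v: "v \<in> S" "trace_symp v c \<noteq> 0" by blast
  have "(\<Sum>u\<in>S. add_char (symp u c)) = (0 :: complex)"
  proof (rule sum_eq_0_of_scaled)
    show "bij_betw (\<lambda>u. u + v) S S" using S v(1) by (rule additive_code_bij_add)
    show "add_char (symp (u + v) c) = add_char (symp v c) * add_char (symp u c)" if "u \<in> S" for u
    proof -
      have "u \<in> word_space n" "v \<in> word_space n" using S that v(1) by (auto simp: additive_code_iff)
      thus ?thesis using c by (simp add: symp_add_left[of _ n] add_char_add)
    qed
    show "add_char (symp v c) \<noteq> 1" using v(2) by (simp add: add_char_eq_1_iff trace_symp_eq)
  qed
  with False show ?thesis by auto
qed

text \<open>Double counting of the sum of \<open>add_char (symp c u)\<close> over all
  \<open>c\<close> in \<open>C\<close> and all words \<open>u\<close>. Summing over \<open>c\<close>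
  first leaves the \<open>u\<close> in the dual, each with weight \<open>card C\<close>; summing
  over \<open>u\<close> first leaves only \<open>c = 0\<close>, by nondegeneracy.\<close>

theorem card_symp_dual:
  fixes C :: "'a :: finite_field word set"
  assumes C: "additive_code n C"
  shows "card C * card (symp_dual n C) = CARD('a) ^ (2 * n)"
proof -
  let ?W = "word_space n :: 'a word set"
  have CW: "c \<in> ?W" if "c \<in> C" for c using C that by (auto simp: additive_code_iff)
  have "(\<Sum>u\<in>?W. \<Sum>c\<in>C. add_char (symp c u)) =
      (\<Sum>u\<in>?W. if u \<in> symp_dual n C then of_nat (card C) else (0 :: complex))"
  proof (rule sum.cong[OF refl])
    fix u assume u: "u \<in> ?W"
    have "(\<forall>c\<in>C. trace_symp c u = 0) \<longleftrightarrow> u \<in> symp_dual n C"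
      using u CW trace_symp_swap_eq_0_iff[OF _ u] by (simp add: symp_dual_def)
    thus "(\<Sum>c\<in>C. add_char (symp c u)) = (if u \<in> symp_dual n C then of_nat (card C) else (0 :: complex))"
      using sum_add_char_symp[OF C u] by simp
  qed
  also have "\<dots> = of_nat (card C * card (symp_dual n C))"
  proof -
    have "?W \<inter> symp_dual n C = symp_dual n C" by (auto simp: symp_dual_def)
    thus ?thesis by (simp add: sum.If_cases mult.commute)
  qed
  also have "(\<Sum>u\<in>?W. \<Sum>c\<in>C. add_char (symp c u)) = (\<Sum>c\<in>C. \<Sum>u\<in>?W. add_char (symp c u) :: complex)"
    by (rule sum.swap)
  also have "\<dots> = (\<Sum>c\<in>C. if c = zero_word n then of_nat (card ?W) else 0)"
  proof (rule sum.cong[OF refl])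
    fix c assume "c \<in> C"
    hence c: "c \<in> ?W" by (rule CW)
    have "trace_symp u (zero_word n) = 0" if "u \<in> ?W" for u
      using trace_symp_swap_eq_0_iff[OF that zero_word_in] that
      by (simp add: trace_symp_eq symp_zero_left)
    hence "(\<forall>u\<in>?W. trace_symp u c = 0) \<longleftrightarrow> c = zero_word n"
      using trace_symp_nondegenerate[OF c] by blast
    hence "(\<Sum>u\<in>?W. add_char (symp u c)) = (if c = zero_word n then of_nat (card ?W) else (0 :: complex))"
      using sum_add_char_symp[OF additive_code_word_space c] by simp
    \<comment> \<open>The available character sum runs over the first argument of the form. Swapping
      the arguments negates the form and so conjugates the sum, whose value is real.\<close>
    moreover have "(\<Sum>u\<in>?W. add_char (symp c u)) = cnj (\<Sum>u\<in>?W. add_char (symp u c))"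
      using symp_swap[OF _ c] by (simp add: add_char_uminus)
    ultimately show "(\<Sum>u\<in>?W. add_char (symp c u)) = (if c = zero_word n then of_nat (card ?W) else (0 :: complex))"
      by simp
  qed
  also have "\<dots> = of_nat (CARD('a) ^ (2 * n))"
    using C additive_code_finite[OF C] by (simp add: additive_code_iff card_word_space)
  finally show ?thesis by (metis of_nat_eq_iff)
qed


section \<open>Shortening and puncturing\<close>

definition word_insert :: "nat \<Rightarrow> 'a \<times> 'a \<Rightarrow> 'a word \<Rightarrow> 'a word" where
  "word_insert i w u = (vec_insert i (fst w) (fst u), vec_insert i (snd w) (snd u))"

lemma word_insert_in_word_space [simp]:
  "word_insert i w u \<in> word_space (Suc n) \<longleftrightarrow> u \<in> word_space n"
  by (auto simp: word_insert_def word_space_def mem_Times_iff)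

lemma word_insert_add:
  fixes u v :: "'a :: plus word"
  assumes "i \<le> n" "u \<in> word_space n" "v \<in> word_space n"
  shows "word_insert i w u + word_insert i z v = word_insert i (w + z) (u + v)"
  using assms by (auto simp: word_insert_def word_space_def vec_insert_add)

lemma word_insert_uminus:
  fixes u :: "'a :: uminus word"
  assumes "i \<le> n" "u \<in> word_space n"
  shows "- word_insert i w u = word_insert i (- w) (- u)"
  using assms by (auto simp: word_insert_def word_space_def vec_insert_uminus)

lemma word_insert_zero: "i \<le> n \<Longrightarrow> word_insert i 0 (zero_word n) = zero_word (Suc n)"
  by (simp add: word_insert_def zero_word_def vec_insert_zero)

lemma word_insert_inject:
  assumes "i \<le> n" "u \<in> word_space n" "v \<in> word_space n"
  shows "word_insert i w u = word_insert i z v \<longleftrightarrow> w = z \<and> u = v"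
  using assms by (auto simp: word_insert_def word_space_def vec_insert_inject prod_eq_iff)

lemma word_insert_eq_zero_iff:
  assumes "i \<le> n" "u \<in> word_space n"
  shows "word_insert i w u = zero_word (Suc n) \<longleftrightarrow> w = 0 \<and> u = zero_word n"
  using word_insert_inject[OF assms zero_word_in, of w 0] word_insert_zero[OF assms(1)] by metis

lemma word_insert_cases:
  assumes "i \<le> n" "c \<in> word_space (Suc n)"
  obtains w u where "u \<in> word_space n" "c = word_insert i w u"
proof -
  from assms(2) have "fst c \<in> carrier_vec (Suc n)" "snd c \<in> carrier_vec (Suc n)"
    by (auto simp: word_space_def)
  then obtain k x l y where "x \<in> carrier_vec n" "fst c = vec_insert i k x"
      "y \<in> carrier_vec n" "snd c = vec_insert i l y"
    using vec_insert_cases[OF assms(1)] by metis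
  hence "(x, y) \<in> word_space n" "c = word_insert i (k, l) (x, y)"
    by (auto simp: word_space_def word_insert_def prod_eq_iff)
  thus ?thesis by (rule that)
qed

lemma symp_word_insert:
  assumes "i \<le> n" "u \<in> word_space n" "v \<in> word_space n"
  shows "symp (word_insert i w u) (word_insert i z v) =
    symp u v + (fst z * snd w - fst w * snd z)"
  using assms
  by (auto simp: symp_def word_insert_def word_space_def vec_insert_scalar_prod[where n = n])

lemma swt_word_insert:
  assumes "i \<le> n" "u \<in> word_space n"
  shows "swt (word_insert i w u) = swt u + (if w = 0 then 0 else 1)"
proof -
  let ?c = "word_insert i w u"
  let ?nz = "\<lambda>v j. (fst v $ j, snd v $ j) \<noteq> (0, 0)"
  let ?S = "{j. j < n \<and> ?nz u j}"
  have dims: "dim_vec (fst u) = n" "dim_vec (snd u) = n" using assms(2) by (auto simp: word_space_def)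
  have dimc: "dim_vec (fst ?c) = Suc n" using dims by (simp add: word_insert_def)
  have same: "?nz ?c i \<longleftrightarrow> w \<noteq> 0"
    using assms(1) dims by (auto simp: word_insert_def vec_insert_same prod_eq_iff)
  have other: "?nz ?c (insert_index i j) \<longleftrightarrow> ?nz u j" if "j < n" for j
    using that dims by (simp add: word_insert_def vec_insert_insert_index)
  have "{j. j < Suc n \<and> ?nz ?c j} = {j \<in> {0..<Suc n}. ?nz ?c j}" by auto
  also have "\<dots> = {j \<in> {i}. ?nz ?c j} \<union> insert_index i ` {j \<in> {0..<n}. ?nz ?c (insert_index i j)}"
    unfolding insert_index_image'[OF assms(1)] by blast
  also have "{j \<in> {i}. ?nz ?c j} = (if w = 0 then {} else {i})"
    using same by auto
  also have "{j \<in> {0..<n}. ?nz ?c (insert_index i j)} = ?S"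
    using other by auto
  finally have "swt ?c = card ((if w = 0 then {} else {i}) \<union> insert_index i ` ?S)"
    by (simp add: swt_def dimc)
  also have "\<dots> = (if w = 0 then 0 else 1) + card (insert_index i ` ?S)"
    by (subst card_Un_disjoint) (auto simp: insert_index_neq[symmetric])
  also have "card (insert_index i ` ?S) = swt u"
    by (simp add: card_image[OF insert_index_inj_on] swt_def dims)
  finally show ?thesis by simp
qed

lemma swt_zero_word [simp]: "swt (zero_word n) = 0"
  by (simp add: swt_def zero_word_def)

section \<open>Shortened and punctured codes: additivity, duality and size\<close>

definition shorten :: "nat \<Rightarrow> nat \<Rightarrow> 'a :: zero word set \<Rightarrow> 'a word set" where
  "shorten n i C = {u \<in> word_space n. word_insert i 0 u \<in> C}"

definition puncture :: "nat \<Rightarrow> nat \<Rightarrow> 'a word set \<Rightarrow> 'a word set" where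
  "puncture n i C = {u \<in> word_space n. \<exists>w. word_insert i w u \<in> C}"

lemma additive_code_shorten:
  assumes "additive_code (Suc n) C" "i \<le> n"
  shows "additive_code n (shorten n i C)"
proof -
  have "word_insert i 0 (u + v) \<in> C" if "u \<in> shorten n i C" "v \<in> shorten n i C" for u v
  proof -
    have "word_insert i 0 u + word_insert i 0 v \<in> C"
      using that assms(1) by (simp add: shorten_def additive_code_iff)
    thus ?thesis using that assms(2) by (simp add: shorten_def word_insert_add)
  qed
  moreover have "word_insert i 0 (- u) \<in> C" if "u \<in> shorten n i C" for u
    using that assms word_insert_uminus[of i n u 0] by (auto simp: shorten_def additive_code_iff)
  ultimately show ?thesis
    using assms word_insert_zero[of i n, where 'a = 'a]
    by (auto simp: additive_code_iff shorten_def word_space_add word_space_uminus)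
qed

lemma puncture_symp_dual_subset:
  assumes "i \<le> n"
  shows "puncture n i (symp_dual (Suc n) C) \<subseteq> symp_dual n (shorten n i C)"
proof
  fix u assume "u \<in> puncture n i (symp_dual (Suc n) C)"
  then obtain w where u: "u \<in> word_space n" "word_insert i w u \<in> symp_dual (Suc n) C"
    by (auto simp: puncture_def)
  have "trace_symp u v = 0" if v: "v \<in> shorten n i C" for v
  proof -
    have "trace_symp (word_insert i w u) (word_insert i 0 v) = 0"
      using u(2) v by (auto simp: symp_dual_def shorten_def)
    moreover have "v \<in> word_space n" using v by (simp add: shorten_def)
    ultimately show ?thesis
      using assms u(1) by (simp add: trace_symp_eq symp_word_insert[where n = n])
  qed
  thus "u \<in> symp_dual n (shorten n i C)" using u(1) by (simp add: symp_dual_def)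
qed

text \<open>Deleting coordinate \<open>i\<close> is injective on \<open>C\<close>: two codewords
  with the same image differ by a codeword supported at \<open>i\<close> alone, whose weight is at
  most 1 and which is therefore zero.\<close>

lemma card_puncture:
  assumes C: "additive_code (Suc n) C" and i: "i \<le> n"
    and wt: "\<And>c. c \<in> C \<Longrightarrow> c \<noteq> zero_word (Suc n) \<Longrightarrow> 2 \<le> swt c"
  shows "card (puncture n i C) = card C"
proof -
  have uniq: "w = z" if u: "u \<in> word_space n" and wz: "word_insert i w u \<in> C" "word_insert i z u \<in> C"
    for u w z
  proof -
    let ?c = "word_insert i (w + - z) (zero_word n)"
    have "word_insert i w u + - word_insert i z u \<in> C" using C wz by (auto simp: additive_code_iff)
    hence "?c \<in> C"
      using i u by (simp add: word_insert_uminus[where n = n] word_insert_add[where n = n]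
        word_space_uminus word_add_uminus_self)
    moreover have "swt ?c < 2" using i by (simp add: swt_word_insert[where n = n])
    ultimately have "?c = zero_word (Suc n)" using wt by fastforce
    thus ?thesis using i by (simp add: word_insert_eq_zero_iff)
  qed
  \<comment> \<open>\<open>f u\<close> is the symbol pair, unique by \<open>uniq\<close>, that
    restores a codeword from the punctured word \<open>u\<close>.\<close>
  define f where "f u = (SOME w. word_insert i w u \<in> C)" for u
  have f: "word_insert i (f u) u \<in> C" if "u \<in> puncture n i C" for u
    unfolding f_def using that by (auto simp: puncture_def intro: someI)
  have "bij_betw (\<lambda>u. word_insert i (f u) u) (puncture n i C) C"
  proof (rule bij_betwI')
    show "word_insert i (f u) u = word_insert i (f v) v \<longleftrightarrow> u = v"
      if "u \<in> puncture n i C" "v \<in> puncture n i C" for u v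
      using that i by (auto simp: puncture_def word_insert_inject)
    show "word_insert i (f u) u \<in> C" if "u \<in> puncture n i C" for u using that by (rule f)
    show "\<exists>u\<in>puncture n i C. c = word_insert i (f u) u" if c: "c \<in> C" for c
    proof -
      have "c \<in> word_space (Suc n)" using C c by (auto simp: additive_code_iff)
      then obtain w u where u: "u \<in> word_space n" "c = word_insert i w u"
        using word_insert_cases[OF i] by metis
      hence p: "u \<in> puncture n i C" using c unfolding puncture_def by blast
      moreover have "w = f u" using uniq[OF u(1), of w "f u"] f[OF p] c u(2) by simp
      ultimately show ?thesis using u(2) by blast
    qed
  qed
  thus ?thesis by (rule bij_betw_same_card)
qed

text \<open>The symbol pair at \<open>i\<close> splits \<open>C\<close> into at most
  \<open>q^2\<close> classes. Subtracting a fixed member of a nonempty class cancels that pair and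
  maps the class injectively into the shortened code.\<close>

lemma card_le_card_shorten:
  fixes C :: "'a :: finite_field word set"
  assumes C: "additive_code (Suc n) C" and i: "i \<le> n"
  shows "card C \<le> CARD('a) ^ 2 * card (shorten n i C)"
proof -
  define F where "F w = {u \<in> word_space n. word_insert i w u \<in> C}" for w
  have fin: "finite (F w)" for w by (simp add: F_def)
  have le: "card (F w) \<le> card (shorten n i C)" for w
  proof (cases "F w = {}")
    case False
    then obtain v where v: "v \<in> F w" by blast
    show ?thesis
    proof (rule card_inj_on_le)
      show "inj_on (\<lambda>u. u + - v) (F w)"
        by (rule inj_on_inverseI[where g = "\<lambda>u. u + v"])
          (use v in \<open>simp add: F_def word_add_uminus_cancel(2)[where n = n]\<close>)
      show "(\<lambda>u. u + - v) ` F w \<subseteq> shorten n i C"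
      proof (rule image_subsetI)
        fix u assume u: "u \<in> F w"
        have W: "u \<in> word_space n" "v \<in> word_space n" using u v by (auto simp: F_def)
        have "word_insert i w u + - word_insert i w v \<in> C"
          using u v C by (auto simp: F_def additive_code_iff)
        hence "word_insert i 0 (u + - v) \<in> C"
          using i W by (simp add: word_insert_uminus[where n = n] word_insert_add[where n = n]
            word_space_uminus)
        thus "u + - v \<in> shorten n i C"
          using W by (simp add: shorten_def word_space_add word_space_uminus)
      qed
    qed (use additive_code_shorten[OF assms] additive_code_finite in auto)
  qed simp
  have "C \<subseteq> (\<Union>w. word_insert i w ` F w)"
  proof
    fix c assume c: "c \<in> C"
    hence "c \<in> word_space (Suc n)" using C by (auto simp: additive_code_iff)
    then obtain w u where u: "u \<in> word_space n" "c = word_insert i w u"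
      using word_insert_cases[OF i] by metis
    with c have "u \<in> F w" by (simp add: F_def)
    with u(2) show "c \<in> (\<Union>w. word_insert i w ` F w)" by blast
  qed
  hence "card C \<le> card (\<Union>w. word_insert i w ` F w)" by (intro card_mono) (auto simp: fin)
  also have "\<dots> \<le> (\<Sum>w\<in>UNIV. card (word_insert i w ` F w))" by (rule card_UN_le) simp
  also have "\<dots> \<le> (\<Sum>w\<in>(UNIV :: ('a \<times> 'a) set). card (shorten n i C))"
    by (intro sum_mono order.trans[OF card_image_le le]) (simp add: fin)
  also have "\<dots> = CARD('a) ^ 2 * card (shorten n i C)"
    by (simp add: card_cartesian_product power2_eq_square flip: UNIV_Times_UNIV)
  finally show ?thesis .
qed

text \<open>The counting inequalities for shortening and for the inclusion of the punctured dual in the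
  dual of the shortened code meet in \<open>|C| |C\<^sup>\<bottom>| = q\<^sup>2\<^sup>n\<close>, so both are equalities.\<close>

lemma shorten_symp_dual:
  fixes C :: "'a :: finite_field word set"
  assumes C: "additive_code (Suc n) C" and i: "i \<le> n"
    and wt: "\<And>c. c \<in> symp_dual (Suc n) C \<Longrightarrow> c \<noteq> zero_word (Suc n) \<Longrightarrow> 2 \<le> swt c"
  shows "symp_dual n (shorten n i C) = puncture n i (symp_dual (Suc n) C)"
    and "card C = CARD('a) ^ 2 * card (shorten n i C)"
proof -
  let ?q = "CARD('a)" and ?S = "shorten n i C" and ?P = "puncture n i (symp_dual (Suc n) C)"
  have CW: "C \<subseteq> word_space (Suc n)" using C by (simp add: additive_code_iff)
  note S = additive_code_shorten[OF C i]
  have SW: "?S \<subseteq> word_space n" by (auto simp: shorten_def)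
  have fin: "finite (symp_dual n ?S)"
    using additive_code_symp_dual[OF SW] by (rule additive_code_finite)
  have sub: "?P \<subseteq> symp_dual n ?S" using i by (rule puncture_symp_dual_subset)
  have P: "card ?P = card (symp_dual (Suc n) C)"
    using additive_code_symp_dual[OF CW] i wt by (rule card_puncture)
  \<comment> \<open>Both sides equal \<open>q\<close> to the power \<open>2 * (n + 1)\<close>, by
    the duality count for length \<open>n + 1\<close> and for length \<open>n\<close>.\<close>
  have total: "card C * card ?P = ?q ^ 2 * (card ?S * card (symp_dual n ?S))"
    unfolding P card_symp_dual[OF C] card_symp_dual[OF S] by (simp add: power2_eq_square)
  have le1: "card C \<le> ?q ^ 2 * card ?S" using C i by (rule card_le_card_shorten)
  have le2: "card ?P \<le> card (symp_dual n ?S)" using fin sub by (rule card_mono)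
  have "card C * card ?P > 0"
    unfolding P card_symp_dual[OF C] by simp
  hence pos: "card C > 0" "card ?P > 0" by auto
  \<comment> \<open>Multiplying \<open>le1\<close> by the size of the dual of \<open>?S\<close> and
    inserting \<open>total\<close> reverses the inequality \<open>le2\<close>, up to the positive
    factor \<open>card C\<close>.\<close>
  have "card C * card (symp_dual n ?S) \<le> card C * card ?P"
    unfolding total using mult_le_mono1[OF le1] by (simp add: mult.assoc)
  hence eqP: "card ?P = card (symp_dual n ?S)" using pos le2 by simp
  show "symp_dual n ?S = ?P" using card_subset_eq[OF fin sub eqP] by simp
  show "card C = ?q ^ 2 * card ?S" using total pos unfolding eqP by simp
qed


section \<open>Errors and slices of states\<close>

lemma error_op_eq:
  "error_op n w \<psi> =
    (\<lambda>x. if x \<in> carrier_vec n then add_char (snd w \<bullet> (x - fst w)) * \<psi> (x - fst w) else 0)"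
  by (induct w) (auto simp: fun_eq_iff)

lemma error_op_scale: "error_op n w (\<lambda>x. z * \<psi> x) = (\<lambda>x. z * error_op n w \<psi> x)"
  by (auto simp: error_op_eq)

lemma error_op_zero_word:
  fixes \<psi> :: "'a :: finite_field state"
  assumes "\<psi> \<in> state_space n"
  shows "error_op n (zero_word n) \<psi> = \<psi>"
  using assms by (auto simp: error_op_eq zero_word_def state_space_def)

text \<open>Both orders perform the same shift, and their phases differ only in the cross terms
  \<open>b \<bullet> a'\<close> and \<open>b' \<bullet> a\<close>, which make up the symplectic
  form.\<close>

lemma error_op_commute:
  fixes v w :: "'a :: finite_field word"
  assumes "v \<in> word_space n" "w \<in> word_space n"
  shows "error_op n v (error_op n w \<psi>) = (\<lambda>x. add_char (symp v w) * error_op n w (error_op n v \<psi>) x)"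
proof
  fix x
  obtain a b a' b' where vw: "v = (a, b)" "w = (a', b')" by (metis surj_pair)
  have carr: "a \<in> carrier_vec n" "b \<in> carrier_vec n" "a' \<in> carrier_vec n" "b' \<in> carrier_vec n"
    using assms by (auto simp: vw word_space_def)
  show "error_op n v (error_op n w \<psi>) x = add_char (symp v w) * error_op n w (error_op n v \<psi>) x"
  proof (cases "x \<in> carrier_vec n")
    case x: True
    have shift: "x - a - a' = x - a' - a"
      using carr x by (intro eq_vecI) auto
    have xa: "x - a \<in> carrier_vec n" "x - a' \<in> carrier_vec n" using carr x by auto
    have "b \<bullet> (x - a) + b' \<bullet> (x - a - a') = symp v w + (b' \<bullet> (x - a') + b \<bullet> (x - a' - a))"
      using carr x xa comm_scalar_prod[of a' n b] comm_scalar_prod[of a n b']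
      by (simp add: scalar_prod_minus_distrib[where n = n] symp_def vw)
    hence "add_char (b \<bullet> (x - a)) * add_char (b' \<bullet> (x - a - a')) =
        add_char (symp v w) * (add_char (b' \<bullet> (x - a')) * add_char (b \<bullet> (x - a' - a)))"
      by (metis add_char_add)
    thus ?thesis using x xa by (simp add: vw error_op_eq shift)
  qed (simp add: error_op_eq)
qed

lemma state_inner_scale:
  "state_inner n (\<lambda>x. y * \<phi> x) (\<lambda>x. z * \<psi> x) = cnj y * z * state_inner n \<phi> \<psi>"
  by (simp add: state_inner_def sum_distrib_left mult_ac)

text \<open>Errors preserve inner products: the shift permutes the basis and the phases have modulus
  1.\<close>

lemma state_inner_error_op:
  fixes v :: "'a :: finite_field word"
  assumes "v \<in> word_space n"
  shows "state_inner n (error_op n v \<phi>) (error_op n v \<psi>) = state_inner n \<phi> \<psi>"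
proof -
  obtain a b where v: "v = (a, b)" "a \<in> carrier_vec n" using assms by (auto simp: word_space_def)
  have bij: "bij_betw (\<lambda>x. x - a) (carrier_vec n) (carrier_vec n)"
    by (rule bij_betw_byWitness[where f' = "\<lambda>x. x + a"]) (use v(2) in \<open>auto intro!: eq_vecI\<close>)
  have unit: "cnj (add_char y) * add_char y = 1" for y :: 'a
    by (simp flip: add_char_uminus add_char_add)
  have "state_inner n (error_op n v \<phi>) (error_op n v \<psi>) =
      (\<Sum>x\<in>carrier_vec n. cnj (add_char (b \<bullet> (x - a))) * add_char (b \<bullet> (x - a)) *
        (cnj (\<phi> (x - a)) * \<psi> (x - a)))"
    by (simp add: state_inner_def v mult_ac)
  also have "\<dots> = (\<Sum>x\<in>carrier_vec n. cnj (\<phi> (x - a)) * \<psi> (x - a))"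
    by (simp add: unit)
  also have "\<dots> = state_inner n \<phi> \<psi>"
    unfolding state_inner_def by (rule sum.reindex_bij_betw[OF bij])
  finally show ?thesis .
qed

text \<open>Conjugating \<open>w\<close> by \<open>v\<close> multiplies it by a phase different from 1, yet preserves its matrix
  entries between eigenvectors of \<open>v\<close> for a common eigenvalue.\<close>

lemma state_inner_error_op_eq_0:
  fixes v w :: "'a :: finite_field word"
  assumes vw: "v \<in> word_space n" "w \<in> word_space n" "trace_symp v w \<noteq> 0"
    and eig: "error_op n v \<phi> = (\<lambda>x. z * \<phi> x)" "error_op n v \<psi> = (\<lambda>x. z * \<psi> x)"
    and unit: "state_inner n \<phi> \<phi> = 1"
  shows "state_inner n \<phi> (error_op n w \<psi>) = 0"
proof -
  let ?I = "state_inner n \<phi> (error_op n w \<psi>)"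
  \<comment> \<open>An eigenvalue of an isometry at a unit vector has modulus 1.\<close>
  have z: "cnj z * z = 1"
    using state_inner_error_op[OF vw(1), of \<phi> \<phi>] unit by (simp add: eig state_inner_scale)
  have "?I = state_inner n (error_op n v \<phi>) (error_op n v (error_op n w \<psi>))"
    by (simp add: state_inner_error_op[OF vw(1)])
  also have "\<dots> = state_inner n (\<lambda>x. z * \<phi> x) (\<lambda>x. (add_char (symp v w) * z) * error_op n w \<psi> x)"
    by (simp add: error_op_commute[OF vw(1,2)] eig error_op_scale mult.assoc)
  also have "\<dots> = cnj z * z * add_char (symp v w) * ?I"
    unfolding state_inner_scale by (simp add: mult_ac)
  finally have "?I = add_char (symp v w) * ?I" using z by simp
  moreover have "add_char (symp v w) \<noteq> 1"
    using vw(3) by (simp add: add_char_eq_1_iff trace_symp_eq)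
  ultimately show ?thesis by simp
qed

text \<open>Up to the factor \<open>\<surd>q\<close>, the contraction of \<open>\<psi>\<close> with the basis vector of \<open>k\<close> at coordinate \<open>i\<close>.\<close>

definition slice :: "nat \<Rightarrow> 'a :: finite_field \<Rightarrow> 'a state \<Rightarrow> 'a state" where
  "slice i k \<psi> = (\<lambda>x. of_real (sqrt (real CARD('a))) * \<psi> (vec_insert i k x))"

lemma slice_in_state_space: "\<psi> \<in> state_space (Suc n) \<Longrightarrow> slice i k \<psi> \<in> state_space n"
  by (simp add: state_space_def slice_def)

text \<open>The inserted pair is zero, so the longer error neither shifts nor phases coordinate
  \<open>i\<close> and commutes with the contraction there.\<close>

lemma error_op_slice:
  assumes "i \<le> n" "u \<in> word_space n" "\<psi> \<in> state_space (Suc n)"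
  shows "error_op n u (slice i k \<psi>) = slice i k (error_op (Suc n) (word_insert i 0 u) \<psi>)"
proof
  fix x
  obtain a b where u: "u = (a, b)" "a \<in> carrier_vec n" "b \<in> carrier_vec n"
    using assms(2) by (auto simp: word_space_def)
  show "error_op n u (slice i k \<psi>) x = slice i k (error_op (Suc n) (word_insert i 0 u) \<psi>) x"
  proof (cases "x \<in> carrier_vec n")
    case True
    hence "x - a \<in> carrier_vec n" using u(2) by simp
    with True show ?thesis
      using assms(1) u by (simp add: slice_def word_insert_def vec_insert_minus[where n = n]
        vec_insert_scalar_prod[where n = n])
  qed (simp add: error_op_eq slice_def)
qed

text \<open>The operator \<open>|k\<rangle>\<langle>l|\<close> at coordinate \<open>i\<close> is a linear combination of the errors at \<open>i\<close>; this
  expresses entries between slices through entries between states of length \<open>n + 1\<close>.\<close>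

lemma state_inner_slice:
  fixes u :: "'a :: finite_field word"
  assumes i: "i \<le> n" and u: "u \<in> word_space n"
  shows "state_inner n (slice i k \<phi>) (error_op n u (slice i l \<psi>)) =
    (\<Sum>b\<in>UNIV. add_char (- (b * l)) *
      state_inner (Suc n) \<phi> (error_op (Suc n) (word_insert i (k - l, b) u) \<psi>))"
proof -
  obtain a c where ac: "u = (a, c)" "a \<in> carrier_vec n" "c \<in> carrier_vec n"
    using u by (auto simp: word_space_def)
  let ?q = "of_nat CARD('a) :: complex"
  \<comment> \<open>\<open>g\<close> is the summand without its dependence on \<open>b\<close>; what
    depends on \<open>b\<close> is a pure character value.\<close>
  define g where "g m x = cnj (\<phi> (vec_insert i m x)) *
    (add_char (c \<bullet> (x - a)) * \<psi> (vec_insert i (m - (k - l)) (x - a)))" for m x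
  have "(\<Sum>b\<in>UNIV. add_char (- (b * l)) *
      state_inner (Suc n) \<phi> (error_op (Suc n) (word_insert i (k - l, b) u) \<psi>)) =
      (\<Sum>b\<in>UNIV. \<Sum>m\<in>UNIV. \<Sum>x\<in>carrier_vec n. add_char (b * (m - k)) * g m x)"
  proof (rule sum.cong[OF refl])
    fix b :: 'a
    have "cnj (\<phi> (vec_insert i m x)) *
        error_op (Suc n) (word_insert i (k - l, b) u) \<psi> (vec_insert i m x) =
        add_char (b * (m - (k - l))) * g m x" if x: "x \<in> carrier_vec n" for m x
    proof -
      have "x - a \<in> carrier_vec n" using x ac(2) by simp
      thus ?thesis
        using i ac x by (simp add: g_def word_insert_def vec_insert_minus[where n = n]
          vec_insert_scalar_prod[where n = n] add_char_add)
    qed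
    hence "state_inner (Suc n) \<phi> (error_op (Suc n) (word_insert i (k - l, b) u) \<psi>) =
        (\<Sum>m\<in>UNIV. \<Sum>x\<in>carrier_vec n. add_char (b * (m - (k - l))) * g m x)"
      unfolding state_inner_def sum_carrier_vec_Suc[OF i] by (intro sum.cong refl) simp
    moreover have "add_char (- (b * l)) * (add_char (b * (m - (k - l))) * g m x) =
        add_char (b * (m - k)) * g m x" for m x
    proof -
      have "b * (m - k) = - (b * l) + b * (m - (k - l))" by (simp add: algebra_simps)
      thus ?thesis by (simp only: add_char_add mult.assoc)
    qed
    ultimately show "add_char (- (b * l)) *
        state_inner (Suc n) \<phi> (error_op (Suc n) (word_insert i (k - l, b) u) \<psi>) =
        (\<Sum>m\<in>UNIV. \<Sum>x\<in>carrier_vec n. add_char (b * (m - k)) * g m x)"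
      by (simp only: sum_distrib_left)
  qed
  also have "\<dots> = (\<Sum>m\<in>UNIV. \<Sum>b\<in>UNIV. \<Sum>x\<in>carrier_vec n. add_char (b * (m - k)) * g m x)"
    by (rule sum.swap)
  also have "\<dots> = (\<Sum>m\<in>UNIV. (\<Sum>b\<in>UNIV. add_char (b * (m - k))) * (\<Sum>x\<in>carrier_vec n. g m x))"
    by (simp add: sum_product)
  \<comment> \<open>Orthogonality in \<open>b\<close> leaves \<open>m = k\<close>, where
    \<open>\<psi>\<close> is evaluated with symbol \<open>l\<close> at coordinate \<open>i\<close>.
    The resulting factor \<open>q\<close> is the product of the two normalizations in
    \<open>slice\<close>.\<close>
  also have "\<dots> = (\<Sum>m\<in>UNIV. if m = k then ?q * (\<Sum>x\<in>carrier_vec n. g k x) else 0)"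
    by (intro sum.cong refl) (simp add: sum_add_char)
  also have "\<dots> = ?q * (\<Sum>x\<in>carrier_vec n. g k x)" by simp
  also have "\<dots> = state_inner n (slice i k \<phi>) (error_op n u (slice i l \<psi>))"
  proof -
    have "?q = of_real (sqrt (real CARD('a))) * of_real (sqrt (real CARD('a)))"
      by (simp flip: of_real_mult)
    thus ?thesis
      by (simp add: state_inner_def slice_def g_def ac sum_distrib_left mult_ac)
  qed
  finally show ?thesis by simp
qed


section \<open>Purity and the minimum distance\<close>

lemma code_radical_subset: "code_radical n C \<subseteq> C"
  by (simp add: code_radical_def)

lemma symp_dual_antimono: "C \<subseteq> C' \<Longrightarrow> symp_dual n C' \<subseteq> symp_dual n C"
  by (auto simp: symp_dual_def)

lemma additive_code_radical:
  assumes "additive_code n C"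
  shows "additive_code n (code_radical n C)"
proof -
  have "additive_code n (symp_dual n C)"
    using assms by (intro additive_code_symp_dual) (simp add: additive_code_iff)
  thus ?thesis using assms by (auto simp: additive_code_iff code_radical_def)
qed

lemma subset_symp_dual_radical:
  assumes "C \<subseteq> word_space n"
  shows "C \<subseteq> symp_dual n (code_radical n C)"
proof
  fix u assume u: "u \<in> C"
  hence uW: "u \<in> word_space n" using assms by blast
  have "trace_symp u v = 0" if "v \<in> code_radical n C" for v
  proof -
    have "v \<in> word_space n" "trace_symp v u = 0"
      using that u by (auto simp: code_radical_def symp_dual_def)
    thus ?thesis using trace_symp_swap_eq_0_iff[OF uW] by blast
  qed
  thus "u \<in> symp_dual n (code_radical n C)" using uW by (simp add: symp_dual_def)
qed

lemma swt_set_attained: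
  assumes "finite S" "u \<in> S" "u \<noteq> zero_word n"
  shows "\<exists>v\<in>S. v \<noteq> zero_word n \<and> swt v = swt_set n S"
proof -
  have "swt_set n S \<in> swt ` (S - {zero_word n})"
    unfolding swt_set_def using assms by (intro Min_in) auto
  thus ?thesis by force
qed

lemma swt_set_le:
  assumes "finite S" "u \<in> S" "u \<noteq> zero_word n"
  shows "swt_set n S \<le> swt u"
  unfolding swt_set_def using assms by (intro Min_le) auto

text \<open>Words of \<open>D'\<close> inside \<open>C\<close> are bounded by purity, those outside
  by the definition of the minimum distance. For a pure code the distance is thus the minimum weight
  of all of \<open>D'\<close>.\<close>

lemma
  fixes C :: "'a :: finite_field word set"
  assumes C: "additive_code n C" "C \<noteq> {zero_word n}" and pure: "pure_to n C (code_min_dist n C)"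
  defines "D' \<equiv> symp_dual n (code_radical n C)"
  shows pure_code_min_dist_le:
      "\<And>u. u \<in> D' \<Longrightarrow> u \<noteq> zero_word n \<Longrightarrow> code_min_dist n C \<le> swt u"
    and pure_code_min_dist_attained:
      "\<exists>u\<in>D'. u \<noteq> zero_word n \<and> swt u = code_min_dist n C"
proof -
  have zero: "zero_word n \<in> C" using C(1) by (simp add: additive_code_iff)
  have sub: "C \<subseteq> D'"
    unfolding D'_def using C(1) by (intro subset_symp_dual_radical) (simp add: additive_code_iff)
  have "D' \<subseteq> word_space n" by (auto simp: D'_def symp_dual_def)
  hence fin: "finite D'" by (rule finite_subset) simp
  define S where "S = (if D' = C then D' else D' - C)"
  have d: "code_min_dist n C = swt_set n S"
    by (simp add: code_min_dist_def D'_def S_def Let_def)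
  have S: "S \<subseteq> D'" "finite S" using fin by (auto simp: S_def)
  \<comment> \<open>\<open>Min\<close> is meaningful only on a nonempty set; when
    \<open>D' = C\<close>, this rests on \<open>C\<close> being nonzero.\<close>
  have "\<exists>u\<in>S. u \<noteq> zero_word n"
  proof (cases "D' = C")
    case True
    hence "S = C" by (simp add: S_def)
    thus ?thesis using zero C(2) by blast
  next
    case False
    then obtain u where "u \<in> D'" "u \<notin> C" using sub by blast
    hence "u \<in> S" "u \<noteq> zero_word n" using zero by (auto simp: S_def)
    thus ?thesis by blast
  qed
  then obtain u where u: "u \<in> S" "u \<noteq> zero_word n" by blast
  show "\<exists>u\<in>D'. u \<noteq> zero_word n \<and> swt u = code_min_dist n C"
    using swt_set_attained[OF S(2) u] S(1) unfolding d by blast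
  show "code_min_dist n C \<le> swt u" if "u \<in> D'" "u \<noteq> zero_word n" for u
  proof (cases "u \<in> C")
    case True
    thus ?thesis using pure that(2) by (auto simp: pure_to_def not_less)
  next
    case False
    hence "u \<in> S" using that(1) by (auto simp: S_def)
    thus ?thesis unfolding d using swt_set_le[OF S(2)] that(2) by blast
  qed
qed

text \<open>Supplies the coordinate for shortening, and shows on the way that the length is
  positive.\<close>

lemma word_nonzero_coordinate:
  fixes w :: "'a :: zero word"
  assumes "w \<in> word_space N" "swt w > 0"
  obtains n i z u where "N = Suc n" "i \<le> n" "z \<noteq> 0" "u \<in> word_space n" "w = word_insert i z u"
proof -
  have dim: "dim_vec (fst w) = N" "dim_vec (snd w) = N" using assms(1) by (auto simp: word_space_def)
  obtain i where i: "i < N" "(fst w $ i, snd w $ i) \<noteq> (0, 0)"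
    using assms(2) by (auto simp: swt_def dim card_gt_0_iff)
  then obtain n where n: "N = Suc n" "i \<le> n" by (cases N) auto
  then obtain z u where zu: "u \<in> word_space n" "w = word_insert i z u"
    using word_insert_cases[OF n(2)] assms(1) by metis
  have "z = (fst w $ i, snd w $ i)"
    using zu n(2) by (auto simp: word_insert_def word_space_def vec_insert_same prod_eq_iff)
  hence "z \<noteq> 0" using i(2) by (simp add: zero_prod_def)
  with n zu that show ?thesis by blast
qed


section \<open>Shortening a pure subsystem code\<close>

text \<open>The word of minimum weight in the dual of the radical comes already split at
  \<open>i\<close> into its nonzero pair \<open>z\<close> and the remainder \<open>w\<close>, which
  has weight \<open>d - 1\<close>. The bound \<open>dual_wt\<close> is the form in which purity
  enters.\<close>

locale pure_code_to_shorten =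
  fixes n i d K R :: nat and C :: "'a :: finite_field word set" and e and z :: "'a \<times> 'a" and w
  assumes code: "clifford_subsystem_code (Suc n) K R d C e"
    and pure: "pure_to (Suc n) C d" and d: "d \<ge> 2" and i: "i \<le> n"
    and dual_wt: "\<And>u. u \<in> symp_dual (Suc n) (code_radical (Suc n) C) \<Longrightarrow>
      u \<noteq> zero_word (Suc n) \<Longrightarrow> d \<le> swt u"
    and w: "w \<in> word_space n" "word_insert i z w \<in> symp_dual (Suc n) (code_radical (Suc n) C)"
      "z \<noteq> 0" "swt (word_insert i z w) = d"
begin

abbreviation "D \<equiv> code_radical (Suc n) C"
abbreviation "C' \<equiv> shorten n i C"
abbreviation "D' \<equiv> shorten n i D"

lemma C: "additive_code (Suc n) C" and
  card_C: "card C * K = CARD('a) ^ Suc n * R" and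
  card_D: "card D * (K * R) = CARD('a) ^ Suc n" and
  basis: "product_basis (Suc n) K R e" and
  derived: "derived_from (Suc n) K R C e"
  using code by (simp_all add: clifford_subsystem_code_def)

lemma KR_pos: "K > 0" "R > 0"
  using card_D by (metis mult_0_right neq0_conv power_not_zero CARD_finite_field_gt_1 not_one_less_zero mult_0)+

lemma D: "additive_code (Suc n) D"
  using C by (rule additive_code_radical)

lemma symp_dual_subset: "symp_dual (Suc n) C \<subseteq> symp_dual (Suc n) D"
  by (rule symp_dual_antimono[OF code_radical_subset])

lemma symp_dual_C': "symp_dual n C' = puncture n i (symp_dual (Suc n) C)"
  and card_C_eq: "card C = CARD('a) ^ 2 * card C'"
  using shorten_symp_dual[OF C i] dual_wt symp_dual_subset d by (meson order.trans subsetD)+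

lemma symp_dual_D': "symp_dual n D' = puncture n i (symp_dual (Suc n) D)"
  and card_D_eq: "card D = CARD('a) ^ 2 * card D'"
  using shorten_symp_dual[OF D i] dual_wt d by (meson order.trans)+

text \<open>A word \<open>u\<close> of the new radical extends by 0 into \<open>C\<close> and by
  some \<open>y\<close> into the dual of \<open>C\<close>. Both extensions lie in the dual of
  \<open>D\<close>, so their difference, supported at \<open>i\<close>, has weight below
  \<open>d\<close> and vanishes. Hence \<open>y = 0\<close>, and the extension by 0 lies in
  \<open>D\<close>.\<close>

lemma code_radical_C': "code_radical n C' = D'"
proof
  show "D' \<subseteq> code_radical n C'"
    unfolding code_radical_def symp_dual_C' unfolding shorten_def puncture_def by blast
  show "code_radical n C' \<subseteq> D'"
  proof
    fix u assume "u \<in> code_radical n C'"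
    hence u: "u \<in> word_space n" "word_insert i 0 u \<in> C" "u \<in> puncture n i (symp_dual (Suc n) C)"
      using symp_dual_C' by (auto simp: code_radical_def shorten_def)
    then obtain y where y: "word_insert i y u \<in> symp_dual (Suc n) C" by (auto simp: puncture_def)
    have "word_insert i 0 u \<in> symp_dual (Suc n) D"
      using u(2) C subset_symp_dual_radical[of C "Suc n"] by (auto simp: additive_code_iff)
    moreover have "additive_code (Suc n) (symp_dual (Suc n) D)"
      using D by (intro additive_code_symp_dual) (simp add: additive_code_iff)
    ultimately have "word_insert i y u + - word_insert i 0 u \<in> symp_dual (Suc n) D"
      using y symp_dual_subset by (auto simp: additive_code_iff)
    hence "word_insert i y (zero_word n) \<in> symp_dual (Suc n) D"
      using i u(1) by (simp add: word_insert_uminus[where n = n] word_insert_add[where n = n]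
        word_space_uminus word_add_uminus_self)
    moreover have "swt (word_insert i y (zero_word n)) < d"
      using i d by (simp add: swt_word_insert[where n = n])
    ultimately have "word_insert i y (zero_word n) = zero_word (Suc n)"
      using dual_wt by (meson not_less)
    hence "y = 0" using i by (simp add: word_insert_eq_zero_iff)
    thus "u \<in> D'" using u y by (simp add: shorten_def code_radical_def)
  qed
qed

section \<open>Weights and minimum distance of the shortened code\<close>

lemma swt_C': "u \<in> C' \<Longrightarrow> u \<noteq> zero_word n \<Longrightarrow> d \<le> swt u"
proof -
  assume u: "u \<in> C'" "u \<noteq> zero_word n"
  hence uW: "u \<in> word_space n" "word_insert i 0 u \<in> C" by (auto simp: shorten_def)
  hence "word_insert i 0 u \<noteq> zero_word (Suc n)" using u(2) i by (simp add: word_insert_eq_zero_iff)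
  hence "d \<le> swt (word_insert i 0 u)" using pure uW(2) by (auto simp: pure_to_def not_less)
  thus "d \<le> swt u" using i uW(1) by (simp add: swt_word_insert)
qed

lemma pure_to_C': "pure_to n C' (d - 1)"
  using swt_C' by (force simp: pure_to_def)

lemma swt_symp_dual_D': "u \<in> symp_dual n D' \<Longrightarrow> u \<noteq> zero_word n \<Longrightarrow> d - 1 \<le> swt u"
proof -
  assume u: "u \<in> symp_dual n D'" "u \<noteq> zero_word n"
  then obtain y where y: "u \<in> word_space n" "word_insert i y u \<in> symp_dual (Suc n) D"
    by (auto simp: symp_dual_D' puncture_def)
  hence "d \<le> swt (word_insert i y u)" using dual_wt u(2) i by (simp add: word_insert_eq_zero_iff)
  thus "d - 1 \<le> swt u" using i y(1) by (simp add: swt_word_insert split: if_splits)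
qed

lemma code_min_dist_C': "code_min_dist n C' = d - 1"
proof -
  have swt_w: "swt w = d - 1" using w i by (simp add: swt_word_insert)
  hence w0: "w \<noteq> zero_word n" using d by auto
  have "w \<in> symp_dual n D'" unfolding symp_dual_D' puncture_def using w by blast
  \<comment> \<open>Nonzero words of \<open>C'\<close> keep weight at least \<open>d\<close>, while
    \<open>w\<close> has weight \<open>d - 1\<close>. So \<open>C'\<close> differs from the dual of
    \<open>D'\<close>, and the first case of \<open>code_min_dist\<close> applies.\<close>
  moreover have "w \<notin> C'" using swt_C' swt_w w0 d by fastforce
  ultimately have wS: "w \<in> symp_dual n D' - C'" by blast
  have fin: "finite (symp_dual n D' - C')"
    by (rule finite_subset[OF _ finite_word_space[of n]]) (auto simp: symp_dual_def)
  have "swt_set n (symp_dual n D' - C') = d - 1"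
  proof (rule antisym)
    show "swt_set n (symp_dual n D' - C') \<le> d - 1"
      using swt_set_le[OF fin wS w0] swt_w by simp
    show "d - 1 \<le> swt_set n (symp_dual n D' - C')"
      using swt_set_attained[OF fin wS w0] swt_symp_dual_D' by (metis DiffD1)
  qed
  thus ?thesis using wS by (auto simp: code_min_dist_def code_radical_C' Let_def)
qed

text \<open>By \<open>dual_wt\<close>, such an error lies outside the dual of \<open>D\<close>, so
  it picks up a nontrivial phase against some \<open>v\<close> in \<open>D\<close>; all basis states
  are eigenvectors of \<open>v\<close> for one common eigenvalue.\<close>

lemma inner_eq_0:
  assumes c: "c \<in> word_space (Suc n)" "c \<noteq> zero_word (Suc n)" "swt c < d"
    and ij: "k < K" "j < R" "k' < K" "j' < R"
  shows "state_inner (Suc n) (e k j) (error_op (Suc n) c (e k' j')) = 0"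
proof -
  have "c \<notin> symp_dual (Suc n) D" using dual_wt c by (meson not_less)
  then obtain v where v: "v \<in> D" "trace_symp c v \<noteq> 0" using c(1) by (auto simp: symp_dual_def)
  have vW: "v \<in> word_space (Suc n)" using v(1) by (auto simp: code_radical_def symp_dual_def)
  obtain y where "\<forall>k<K. \<forall>j<R. error_op (Suc n) v (e k j) = (\<lambda>x. y * e k j x)"
    using derived v(1) unfolding derived_from_def by blast
  moreover have "trace_symp v c \<noteq> 0" using trace_symp_swap_eq_0_iff[OF c(1) vW] v(2) by blast
  ultimately show ?thesis
    using basis ij by (intro state_inner_error_op_eq_0[OF vW c(1)]) (auto simp: product_basis_def)
qed

text \<open>Inserting a pair raises the weight by at most 1, so every error in the expansion has
  weight below \<open>d\<close> and only the zero word contributes. Orthonormality and detectability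
  of the new code both follow from this formula.\<close>

lemma inner_slice:
  assumes u: "u \<in> word_space n" "Suc (swt u) < d"
    and ij: "k < K" "j < R" "k' < K" "j' < R"
  shows "state_inner n (slice i x (e k j)) (error_op n u (slice i x' (e k' j'))) =
    (if u = zero_word n \<and> x = x' \<and> k = k' \<and> j = j' then 1 else 0)"
proof -
  let ?word = "\<lambda>b. word_insert i (x - x', b) u"
  let ?t = "\<lambda>b. add_char (- (b * x')) * state_inner (Suc n) (e k j) (error_op (Suc n) (?word b) (e k' j'))"
  have zero: "?t b = 0" if "?word b \<noteq> zero_word (Suc n)" for b
  proof -
    have "?word b \<in> word_space (Suc n)" using u(1) by simp
    moreover have "swt (?word b) < d" using u i by (simp add: swt_word_insert)
    ultimately show ?thesis using inner_eq_0 that ij by simp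
  qed
  have word_0: "?word b = zero_word (Suc n) \<longleftrightarrow> u = zero_word n \<and> x = x' \<and> b = 0" for b
    using word_insert_eq_zero_iff[OF i u(1)] by (auto simp: zero_prod_def)
  have t0: "?t 0 = (if k = k' \<and> j = j' then 1 else 0)" if "u = zero_word n" "x = x'"
  proof -
    have "?word 0 = zero_word (Suc n)" using that word_0 by simp
    thus ?thesis using basis ij by (simp add: error_op_zero_word product_basis_def)
  qed
  have "state_inner n (slice i x (e k j)) (error_op n u (slice i x' (e k' j'))) = (\<Sum>b\<in>UNIV. ?t b)"
    using i u(1) by (rule state_inner_slice)
  also have "\<dots> = (\<Sum>b\<in>(UNIV :: 'a set). if b = 0 then (if u = zero_word n \<and> x = x' \<and> k = k' \<and> j = j' then 1 else 0) else 0)"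
  proof (rule sum.cong[OF refl])
    fix b :: 'a
    show "?t b = (if b = 0 then (if u = zero_word n \<and> x = x' \<and> k = k' \<and> j = j' then 1 else 0) else 0)"
    proof (cases "?word b = zero_word (Suc n)")
      case True
      hence *: "u = zero_word n" "x = x'" "b = 0" using word_0 by blast+
      show ?thesis unfolding *(3) using t0[OF *(1,2)] * by simp
    next
      case False
      hence "\<not> (b = 0 \<and> u = zero_word n \<and> x = x')" using word_0 by blast
      with zero[OF False] show ?thesis by auto
    qed
  qed
  finally show ?thesis by simp
qed

lemma exists_basis:
  "\<exists>e'. clifford_subsystem_code n (CARD('a) * K) R (d - 1) C' e'"
proof -
  let ?q = "CARD('a)"
  obtain f :: "nat \<Rightarrow> 'a" where f: "bij_betw f {..<?q} UNIV"
    using ex_bij_betw_nat_finite[of "UNIV :: 'a set"] by (auto simp: atLeast0LessThan)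
  \<comment> \<open>\<open>I\<close> encodes a symbol at coordinate \<open>i\<close> (its quotient
    by \<open>K\<close>) and an old index of \<open>A\<close> (its remainder). The index of
    \<open>B\<close> is untouched, so the dimension of \<open>A\<close> grows by the factor
    \<open>q\<close> and \<open>R\<close> stays.\<close>
  define e' where "e' I j = slice i (f (I div K)) (e (I mod K) j)" for I j
  have mod: "I mod K < K" "I div K < ?q" if "I < ?q * K" for I
    using that KR_pos(1) by (auto simp: less_mult_imp_div_less)
  have f_eq: "f (I div K) = f (I' div K) \<and> I mod K = I' mod K \<longleftrightarrow> I = I'"
    if "I < ?q * K" "I' < ?q * K" for I I'
    using mod[OF that(1)] mod[OF that(2)] bij_betw_imp_inj_on[OF f]
    by (metis inj_onD lessThan_iff div_mult_mod_eq)
  have space: "e k j \<in> state_space (Suc n)" if "k < K" "j < R" for k j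
    using basis that by (simp add: product_basis_def)
  have inner: "state_inner n (e' I j) (error_op n u (e' I' j')) =
      (if u = zero_word n \<and> I = I' \<and> j = j' then 1 else 0)"
    if "u \<in> word_space n" "Suc (swt u) < d" "I < ?q * K" "j < R" "I' < ?q * K" "j' < R" for u I j I' j'
    using inner_slice[OF that(1,2) mod(1)[OF that(3)] that(4) mod(1)[OF that(5)] that(6)] f_eq[OF that(3,5)]
    unfolding e'_def by auto
  have basis': "product_basis n (?q * K) R e'"
    unfolding product_basis_def
  proof (intro conjI allI impI)
    show space': "e' I j \<in> state_space n" if "I < ?q * K" "j < R" for I j
      using that mod(1) space by (auto simp: e'_def intro!: slice_in_state_space)
    \<comment> \<open>Orthonormality is the case of the zero word in \<open>inner\<close>, where the
      weight condition reads \<open>1 < d\<close>.\<close>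
    show "state_inner n (e' I j) (e' I' j') = (if I = I' \<and> j = j' then 1 else 0)"
      if "I < ?q * K" "j < R" "I' < ?q * K" "j' < R" for I j I' j'
      using inner[of "zero_word n" I j I' j'] that d error_op_zero_word[OF space'] by simp
  qed
  \<comment> \<open>Errors of \<open>C'\<close> act on slices through their extensions by 0 in
    \<open>C\<close>, so the matrices and scalars of the old code carry over unchanged.\<close>
  have act: "error_op n c (e' I j) = slice i (f (I div K)) (error_op (Suc n) (word_insert i 0 c) (e (I mod K) j))"
    if "c \<in> word_space n" "I < ?q * K" "j < R" for c I j
    unfolding e'_def using error_op_slice[OF i that(1) space] that mod(1) by blast
  have derived': "derived_from n (?q * K) R C' e'"
    unfolding derived_from_def code_radical_C'
  proof (intro conjI ballI)
    fix c assume c: "c \<in> C'"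
    then obtain M where "\<forall>k<K. \<forall>j<R. error_op (Suc n) (word_insert i 0 c) (e k j) =
        (\<lambda>x. \<Sum>j'<R. M j' j * e k j' x)"
      using derived unfolding derived_from_def shorten_def by blast
    thus "\<exists>M. \<forall>I<?q * K. \<forall>j<R. error_op n c (e' I j) = (\<lambda>x. \<Sum>j'<R. M j' j * e' I j' x)"
      using act c mod(1)
      by (intro exI[of _ M]) (auto simp: shorten_def e'_def slice_def sum_distrib_left mult_ac)
  next
    fix c assume c: "c \<in> D'"
    then obtain y where "\<forall>k<K. \<forall>j<R. error_op (Suc n) (word_insert i 0 c) (e k j) = (\<lambda>x. y * e k j x)"
      using derived unfolding derived_from_def shorten_def by blast
    thus "\<exists>y. \<forall>I<?q * K. \<forall>j<R. error_op n c (e' I j) = (\<lambda>x. y * e' I j x)"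
      using act c mod(1) by (intro exI[of _ y]) (auto simp: shorten_def e'_def slice_def mult_ac)
  qed
  \<comment> \<open>The operator on \<open>B\<close> is the identity for the zero word and 0 for
    every other error of weight below \<open>d - 1\<close>.\<close>
  have detect: "detectable n (?q * K) R e' (error_op n u)" if "u \<in> word_space n" "swt u < d - 1" for u
    unfolding detectable_def
    using inner[OF that(1)] that(2)
    by (intro exI[of _ "\<lambda>j j'. if u = zero_word n \<and> j = j' then 1 else 0"]) auto
  \<comment> \<open>Shortening divides the size by \<open>q^2\<close>: one factor \<open>q\<close>
    moves into the new dimension of \<open>A\<close>, the other accounts for the lost
    coordinate.\<close>
  have "card C' * (?q * K) = ?q ^ n * R"
    using card_C unfolding card_C_eq by (simp add: power2_eq_square mult.left_commute)
  moreover have "card D' * (?q * K * R) = ?q ^ n"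
    using card_D unfolding card_D_eq by (simp add: power2_eq_square mult_ac)
  ultimately have "clifford_subsystem_code n (?q * K) R (d - 1) C' e'"
    using additive_code_shorten[OF C i] basis' derived' detect pure_to_C'
    by (simp add: clifford_subsystem_code_def code_radical_C' code_min_dist_C')
  thus ?thesis by blast
qed

lemma shortened_code:
  "\<exists>e'. (C' \<noteq> {zero_word n} \<or> CARD('a) * K = CARD('a) ^ n) \<and>
     pure_subsystem_code n (CARD('a) * K) R (d - 1) C' e'"
proof -
  let ?q = "CARD('a)"
  obtain e' where e': "clifford_subsystem_code n (?q * K) R (d - 1) C' e'"
    using exists_basis by blast
  have "?q * K = ?q ^ n" if triv: "C' = {zero_word n}"
  proof -
    have "zero_word n \<in> code_radical n C'"
      using additive_code_radical[OF additive_code_shorten[OF C i]] by (simp add: additive_code_iff)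
    hence "code_radical n C' = {zero_word n}" using triv code_radical_subset by blast
    hence eq: "?q * K = ?q ^ n * R" "?q * K * R = ?q ^ n"
      using e' triv by (auto simp: clifford_subsystem_code_def)
    \<comment> \<open>Code and radical coincide here, so the two cardinality conditions together
      force \<open>R = 1\<close>.\<close>
    hence "?q ^ n * (R * R) = ?q ^ n * 1" by (simp add: mult.assoc)
    hence "R * R = 1" by (subst (asm) mult_cancel1) auto
    thus ?thesis using eq by simp
  qed
  thus ?thesis using e' pure_to_C' by (auto simp: pure_subsystem_code_def)
qed

end

theorem theorem26:
  fixes n K R d q :: nat
  assumes "q = CARD('a :: finite_field)"
    and "d \<ge> 2"
    and "\<exists>(C :: 'a word set) e. C \<noteq> {zero_word n} \<and> pure_subsystem_code n K R d C e"
  shows "\<exists>(C' :: 'a word set) e'. (C' \<noteq> {zero_word (n - 1)} \<or> q * K = q ^ (n - 1)) \<and>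
           pure_subsystem_code (n - 1) (q * K) R (d - 1) C' e'"
proof -
  obtain C :: "'a word set" and e where
    C: "C \<noteq> {zero_word n}" "clifford_subsystem_code n K R d C e" "pure_to n C d"
    using assms(3) by (auto simp: pure_subsystem_code_def)
  hence add: "additive_code n C" and d: "d = code_min_dist n C"
    by (simp_all add: clifford_subsystem_code_def)
  note pure = C(3)[unfolded d]
  \<comment> \<open>\<open>c\<close> has minimum weight in the dual of the radical. Its weight is at
    least 2, so it has a nonzero coordinate at which to shorten.\<close>
  obtain c where c: "c \<in> symp_dual n (code_radical n C)" "swt c = d"
    using pure_code_min_dist_attained[OF add C(1) pure] d by blast
  have "c \<in> word_space n" using c(1) by (simp add: symp_dual_def)
  then obtain m i z u where m: "n = Suc m" "i \<le> m" "z \<noteq> 0" "u \<in> word_space m"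
      "c = word_insert i z u"
    using word_nonzero_coordinate c(2) assms(2) by (metis less_le_trans zero_less_numeral)
  interpret pure_code_to_shorten m i d K R C e z u
  proof
    show "d \<le> swt v" if "v \<in> symp_dual (Suc m) (code_radical (Suc m) C)" "v \<noteq> zero_word (Suc m)" for v
      using pure_code_min_dist_le[OF add C(1) pure] that d m(1) by simp
  qed (use C assms(2) m c in auto)
  show ?thesis using shortened_code assms(1) m(1) by auto
qed

end
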